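(* Let $n$ be a positive integer and write $2n+5=3^{\beta}n_1$ with $n_1$ a positive integer and $3\nmid n_1$. Then $$t(1,3,4,12;n)=2\big(\sigma(n_1)-(-1)^na(2n+5)\big).$$
   Context: $\sigma(n)=\sum_{d\mid n,\,d\ge1}d$. The integers $a(n)$ ($n\ge1$) are defined by $q\prod_{k=1}^{\infty}(1-q^{2k})(1-q^{4k})(1-q^{6k})(1-q^{12k})=\sum_{n=1}^{\infty}a(n)q^n$ for $|q|<1$. For positive integers $a,b,c,d$ and a nonnegative integer $n$, $t(a,b,c,d;n)$ denotes the number of $(x,y,z,w)\in\mathbb Z^4$ with $n=a\frac{x(x-1)}2+b\frac{y(y-1)}2+c\frac{z(z-1)}2+d\frac{w(w-1)}2$. *)

theory Defs
  imports "HOL-Complex_Analysis.Complex_Analysis"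
begin

definition divisor_sigma :: "nat \<Rightarrow> nat" where
  "divisor_sigma n = (\<Sum>d | d dvd n. d)"

text \<open>
  The product runs over \<^term>\<open>k \<ge> (1::nat)\<close>, hence the index shift. It is taken in the topology of
  formal power series; it converges there (\<open>eta_factor_has_prod\<close>), and the resulting coefficients
  are those of the analytic identity on the unit disc (\<open>eta_coeff_sums\<close>).
\<close>

definition eta_factor :: "nat \<Rightarrow> 'a :: comm_ring_1 \<Rightarrow> 'a" where
  "eta_factor k q = (1 - q ^ (2*k)) * (1 - q ^ (4*k)) * (1 - q ^ (6*k)) * (1 - q ^ (12*k))"

definition eta_coeff :: "nat \<Rightarrow> int" where
  "eta_coeff n = fps_nth (fps_X * (\<Prod>k. eta_factor (Suc k) fps_X)) n"

text \<open>For positive \<open>a\<close>, \<open>b\<close>, \<open>c\<close>, \<open>d\<close> the set is finite; the divisions by 2 are exact.\<close>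

definition num_tri_reps :: "nat \<Rightarrow> nat \<Rightarrow> nat \<Rightarrow> nat \<Rightarrow> nat \<Rightarrow> nat" where
  "num_tri_reps a b c d n = card {(x :: int, y :: int, z :: int, w :: int).
     int n = int a * (x * (x - 1) div 2) + int b * (y * (y - 1) div 2)
           + int c * (z * (z - 1) div 2) + int d * (w * (w - 1) div 2)}"


lemma eta_factor_fps:
  "\<exists>G. eta_factor (Suc k) (fps_X :: 'a :: comm_ring_1 fps) = 1 + fps_X ^ Suc k * G"
proof -
  let ?X = "fps_X ^ Suc k :: 'a fps"
  have single: "?X dvd (1 - fps_X ^ (m * Suc k)) - 1" if "m \<ge> 1" for m
    using that mult_le_mono1[of 1 m "Suc k"] by (auto intro!: le_imp_power_dvd simp del: power_Suc)
  have mult: "?X dvd F * G - 1" if "?X dvd F - 1" "?X dvd G - 1" for F G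
  proof -
    have "F * G - 1 = (F - 1) * G + (G - 1)" by (simp add: algebra_simps)
    thus ?thesis by (metis dvd_add dvd_mult2 that)
  qed
  have "?X dvd eta_factor (Suc k) fps_X - 1"
    unfolding eta_factor_def by (intro mult single) auto
  then obtain H where "eta_factor (Suc k) fps_X - 1 = ?X * H" by (elim dvdE)
  hence "eta_factor (Suc k) fps_X = 1 + ?X * H" by (metis add.commute diff_add_cancel)
  thus ?thesis by blast
qed

lemma eta_partial_nth:
  assumes "n \<le> N"
  shows "fps_nth (\<Prod>k<N. eta_factor (Suc k) (fps_X :: 'a :: comm_ring_1 fps)) n
       = fps_nth (\<Prod>k<n. eta_factor (Suc k) fps_X) n"
  using assms
proof (induction N rule: dec_induct)
  case (step N)
  obtain G where G: "eta_factor (Suc N) (fps_X :: 'a fps) = 1 + fps_X ^ Suc N * G"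
    using eta_factor_fps by blast
  let ?P = "\<Prod>k<N. eta_factor (Suc k) (fps_X :: 'a fps)"
  have "(\<Prod>k<Suc N. eta_factor (Suc k) (fps_X :: 'a fps)) = ?P + fps_X ^ Suc N * (?P * G)"
    by (simp add: G algebra_simps del: power_Suc)
  also have "fps_nth \<dots> n = fps_nth ?P n"
    unfolding fps_add_nth fps_X_power_mult_nth using step by simp
  finally show ?case using step by simp
qed auto

lemma eta_partial_tendsto:
  "(\<lambda>N. \<Prod>k<N. eta_factor (Suc k) (fps_X :: 'a :: comm_ring_1 fps))
     \<longlonglongrightarrow> Abs_fps (\<lambda>n. fps_nth (\<Prod>k<n. eta_factor (Suc k) fps_X) n)"
proof (rule tendsto_fpsI)
  fix n
  show "\<forall>\<^sub>F N in sequentially. fps_nth (\<Prod>k<N. eta_factor (Suc k) (fps_X :: 'a fps)) n =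
     fps_nth (Abs_fps (\<lambda>n. fps_nth (\<Prod>k<n. eta_factor (Suc k) fps_X) n)) n"
    using eventually_ge_at_top[of n]
    by eventually_elim (simp only: fps_nth_Abs_fps eta_partial_nth[symmetric])
qed

lemma eta_factor_has_prod:
  "(\<lambda>k. eta_factor (Suc k) (fps_X :: 'a :: idom fps)) has_prod
     Abs_fps (\<lambda>n. fps_nth (\<Prod>k<n. eta_factor (Suc k) fps_X) n)"
proof -
  let ?L = "Abs_fps (\<lambda>n. fps_nth (\<Prod>k<n. eta_factor (Suc k) (fps_X :: 'a fps)) n)"
  have "fps_nth ?L 0 = 1" by simp
  hence "?L \<noteq> 0" by (metis fps_zero_nth zero_neq_one)
  thus ?thesis
    using eta_partial_tendsto[where ?'a = 'a]
    unfolding has_prod_def raw_has_prod_def LIMSEQ_lessThan_iff_atMost by simp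
qed

lemma eta_prodinf_nth:
  "fps_nth (\<Prod>k. eta_factor (Suc k) (fps_X :: 'a :: idom fps)) n
     = fps_nth (\<Prod>k<n. eta_factor (Suc k) fps_X) n"
  by (subst has_prod_unique[OF eta_factor_has_prod, symmetric]) simp

lemma of_int_fps_hom_mult:
  "Abs_fps (\<lambda>n. of_int (fps_nth (F * G) n)) =
   (Abs_fps (\<lambda>n. of_int (fps_nth F n)) * Abs_fps (\<lambda>n. of_int (fps_nth G n)) :: complex fps)"
  by (rule fps_ext) (simp add: fps_mult_nth)

lemma of_int_fps_hom_factor:
  "Abs_fps (\<lambda>n. of_int (fps_nth (eta_factor k fps_X) n)) = (eta_factor k fps_X :: complex fps)"
proof -
  have "Abs_fps (\<lambda>n. of_int (fps_nth (1 - fps_X ^ m) n)) = (1 - fps_X ^ m :: complex fps)" for m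
    by (rule fps_ext) (simp add: fps_X_power_nth)
  thus ?thesis unfolding eta_factor_def of_int_fps_hom_mult by simp
qed

lemma of_int_fps_hom_partial:
  "Abs_fps (\<lambda>n. of_int (fps_nth (\<Prod>k<N. eta_factor (Suc k) fps_X) n))
     = (\<Prod>k<N. eta_factor (Suc k) fps_X :: complex fps)"
proof (induction N)
  case 0
  show ?case by (rule fps_ext) simp
next
  case (Suc N)
  thus ?case by (simp add: of_int_fps_hom_mult of_int_fps_hom_factor)
qed

lemma of_int_eta_prodinf_nth:
  "of_int (fps_nth (\<Prod>k. eta_factor (Suc k) fps_X) n)
     = fps_nth (\<Prod>k. eta_factor (Suc k) (fps_X :: complex fps)) n"
  unfolding eta_prodinf_nth of_int_fps_hom_partial[of n, symmetric] by simp

lemma norm_eta_factor_bound: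
  fixes z :: complex
  assumes "norm z \<le> r" "r < 1"
  shows "norm (eta_factor (Suc k) z - 1) \<le> 15 * r ^ Suc k"
proof -
  define s where "s = r ^ Suc k"
  have r: "0 \<le> r" using assms(1) norm_ge_zero[of z] by linarith
  have s: "0 \<le> s" "s \<le> 1"
    using r assms(2) by (auto simp: s_def power_le_one simp del: power_Suc)
  have single: "norm ((1 - z ^ (m * Suc k)) - 1) \<le> 1 * s" if "m \<ge> 1" for m
  proof -
    have "norm ((1 - z ^ (m * Suc k)) - 1) = norm z ^ (m * Suc k)"
      by (simp add: norm_power)
    also have "\<dots> \<le> r ^ (m * Suc k)" by (intro power_mono assms) auto
    also have "\<dots> \<le> r ^ Suc k"
      using that r assms(2) mult_le_mono1[of 1 m "Suc k"] by (intro power_decreasing) auto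
    finally show ?thesis by (simp add: s_def)
  qed
  have mult: "norm (x * y - 1) \<le> (c + d + c * d) * s"
    if "norm (x - 1) \<le> c * s" "norm (y - 1) \<le> d * s" "c \<ge> 0" "d \<ge> 0" for x y :: complex and c d
  proof -
    have "x * y - 1 = (x - 1) * (y - 1) + ((x - 1) + (y - 1))" by (simp add: algebra_simps)
    hence "norm (x * y - 1) \<le> norm (x - 1) * norm (y - 1) + (norm (x - 1) + norm (y - 1))"
      by (metis norm_mult norm_triangle_le norm_triangle_ineq add_left_mono)
    also have "\<dots> \<le> (c * s) * (d * s) + (c * s + d * s)"
      using that s by (intro add_mono mult_mono) auto
    also have "(c * s) * (d * s) \<le> (c * d) * s"
    proof -
      have "(c * d * s) * s \<le> (c * d * s) * 1"
        using that s by (intro mult_left_mono) auto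
      thus ?thesis by (simp add: algebra_simps)
    qed
    finally show ?thesis by (simp add: algebra_simps)
  qed
  have "norm (eta_factor (Suc k) z - 1) \<le> 15 * s"
    using mult[OF mult[OF mult[OF single[of 2] single[of 4]] single[of 6]] single[of 12]]
    unfolding eta_factor_def by simp
  thus ?thesis by (simp add: s_def)
qed

lemma eta_factor_nz:
  fixes z :: complex
  assumes "norm z < 1"
  shows "eta_factor (Suc k) z \<noteq> 0"
proof -
  have "z ^ m \<noteq> 1" if "m > 0" for m
  proof
    assume "z ^ m = 1"
    hence "norm z ^ m = 1" by (metis norm_one norm_power)
    moreover have "norm z ^ m < 1"
      using that assms by (simp add: power_less_one_iff)
    ultimately show False by simp
  qed
  from this[of "2 * Suc k"] this[of "4 * Suc k"] this[of "6 * Suc k"] this[of "12 * Suc k"]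
  show ?thesis by (auto simp: eta_factor_def simp del: mult_Suc_right)
qed

lemma eta_uniform_limit:
  assumes "r < 1"
  shows "uniform_limit (cball 0 r) (\<lambda>N z. \<Prod>k<N. eta_factor (Suc k) z)
           (\<lambda>z :: complex. \<Prod>k. eta_factor (Suc k) z) sequentially"
proof (cases "r < 0")
  case False
  hence r: "0 \<le> r" by simp
  have summ: "summable (\<lambda>k. 15 * r ^ Suc k)"
    using r assms by (intro summable_mult) (subst summable_Suc_iff, auto intro: summable_geometric)
  have uc: "uniformly_convergent_on (cball 0 r) (\<lambda>N z. \<Prod>k<N. eta_factor (Suc k) (z :: complex))"
  proof (rule uniformly_convergent_on_prod')
    show "continuous_on (cball 0 r) (eta_factor (Suc n) :: complex \<Rightarrow> complex)" for n
      unfolding eta_factor_def by (intro continuous_intros)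
    show "uniformly_convergent_on (cball 0 r)
            (\<lambda>N x. \<Sum>n<N. norm (eta_factor (Suc n) x - 1 :: complex))"
      by (rule Weierstrass_m_test'[OF _ summ])
         (use norm_eta_factor_bound assms in auto)
  qed auto
  moreover have "lim (\<lambda>N. \<Prod>k<N. eta_factor (Suc k) z) = (\<Prod>k. eta_factor (Suc k) z)"
    if "z \<in> cball 0 r" for z :: complex
  proof -
    have "summable (\<lambda>k. norm (eta_factor (Suc k) z - 1))"
      by (rule summable_comparison_test[OF _ summ])
         (use that norm_eta_factor_bound[of z r] assms in auto)
    hence "convergent_prod (\<lambda>k. eta_factor (Suc k) z)"
      by (simp add: abs_convergent_prod_conv_summable abs_convergent_prod_imp_convergent_prod)
    thus ?thesis
      using that assms by (intro prodinf_eq_lim'[symmetric] eta_factor_nz) auto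
  qed
  ultimately show ?thesis
    unfolding uniformly_convergent_uniform_limit_iff
    by (subst uniform_limit_cong'[where g = "\<lambda>N z. \<Prod>k<N. eta_factor (Suc k) z"
          and i = "\<lambda>z. lim (\<lambda>N. \<Prod>k<N. eta_factor (Suc k) z)"]) auto
qed auto

lemma eta_prodinf_holomorphic:
  "(\<lambda>z :: complex. \<Prod>k. eta_factor (Suc k) z) holomorphic_on ball 0 1"
proof (rule holomorphic_uniform_sequence)
  show "(\<lambda>z. \<Prod>k<N. eta_factor (Suc k) z) holomorphic_on ball (0::complex) 1" for N
    unfolding eta_factor_def by (intro holomorphic_intros)
  fix z :: complex assume z: "z \<in> ball 0 1"
  define d where "d = (1 - norm z) / 2"
  have d: "d > 0" "norm z + d < 1" using z by (auto simp: d_def field_simps)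
  have sub: "cball z d \<subseteq> cball 0 (norm z + d)"
  proof
    fix x assume "x \<in> cball z d"
    thus "x \<in> cball 0 (norm z + d)"
      using norm_triangle_ineq2[of x z] by (auto simp: dist_norm norm_minus_commute)
  qed
  moreover have "cball 0 (norm z + d) \<subseteq> ball (0::complex) 1" using d by auto
  ultimately show "\<exists>d>0. cball z d \<subseteq> ball 0 1 \<and>
      uniform_limit (cball z d) (\<lambda>N z. \<Prod>k<N. eta_factor (Suc k) z)
        (\<lambda>z. \<Prod>k. eta_factor (Suc k) z) sequentially"
    using d eta_uniform_limit[OF d(2)] uniform_limit_on_subset by blast
qed auto

lemma eta_coeff_0: "eta_coeff 0 = 0"
  by (simp add: eta_coeff_def)

theorem eta_coeff_sums:
  fixes q :: complex
  assumes "norm q < 1"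
  shows "(\<lambda>n. of_int (eta_coeff n) * q ^ n) sums (q * (\<Prod>k. eta_factor (Suc k) q))"
proof -
  let ?g = "\<lambda>z :: complex. \<Prod>k. eta_factor (Suc k) z"
  let ?G = "\<Prod>k. eta_factor (Suc k) (fps_X :: complex fps)"
  have exp: "?g has_fps_expansion fps_expansion ?g 0"
    by (intro analytic_at_imp_has_fps_expansion_0)
       (use eta_prodinf_holomorphic in \<open>auto simp: analytic_at intro!: exI[of _ "ball 0 1"]\<close>)
  have "fps_expansion ?g 0 = ?G"
  proof (rule uniform_limit_imp_fps_expansion_eq)
    show "(\<lambda>N. \<Prod>k<N. eta_factor (Suc k) (fps_X :: complex fps)) \<longlonglongrightarrow> ?G"
      unfolding has_prod_unique[OF eta_factor_has_prod, symmetric] by (rule eta_partial_tendsto)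
    show "uniform_limit (ball 0 (1/2)) (\<lambda>N z. \<Prod>k<N. eta_factor (Suc k) z) ?g sequentially"
      by (rule uniform_limit_on_subset[OF eta_uniform_limit[of "1/2"]]) auto
    show "\<forall>\<^sub>F N in sequentially. (\<lambda>z. \<Prod>k<N. eta_factor (Suc k) z) has_fps_expansion
            (\<Prod>k<N. eta_factor (Suc k) (fps_X :: complex fps))"
      unfolding eta_factor_def 
      by (intro always_eventually allI has_fps_expansion_prod has_fps_expansion_mult
            has_fps_expansion_diff has_fps_expansion_1 has_fps_expansion_fps_X_power)
    show "\<forall>\<^sub>F N in sequentially.
            (\<lambda>z. \<Prod>k<N. eta_factor (Suc k) z) holomorphic_on ball (0::complex) (1/2)"
      unfolding eta_factor_def by (intro always_eventually allI holomorphic_intros)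
  qed (use exp in auto)
  hence nth: "(deriv ^^ n) ?g 0 / fact n = fps_nth ?G n" for n
    using fps_nth_fps_expansion[OF exp, of n] by simp
  have "(\<lambda>n. fps_nth ?G n * q ^ n) sums ?g q"
    using holomorphic_power_series[OF eta_prodinf_holomorphic, of q] assms by (simp add: nth)
  hence "(\<lambda>n. q * (fps_nth ?G n * q ^ n)) sums (q * ?g q)"
    by (rule sums_mult)
  also have "(\<lambda>n. q * (fps_nth ?G n * q ^ n)) = (\<lambda>n. of_int (eta_coeff (Suc n)) * q ^ Suc n)"
    by (simp add: eta_coeff_def of_int_eta_prodinf_nth mult_ac)
  finally show ?thesis
    using sums_Suc_iff[of "\<lambda>n. of_int (eta_coeff n) * q ^ n" "q * ?g q"]
    by (simp only: eta_coeff_0 of_int_0 mult_zero_left add_0_right diff_0_right)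
qed

end

theory Submission
  imports Defs "HOL-Library.Nat_Bijection" "HOL-Computational_Algebra.Primes"
begin

text \<open>
  Let \<open>\<phi>(q) = \<Sum> q^(n\<^sup>2)\<close> over all integers and \<open>\<psi>(q) = \<Sum> q^(n(n+1)/2)\<close> over \<open>n \<ge> 0\<close>, so that
  \<open>16 \<psi>(q) \<psi>(q\<^sup>3) \<psi>(q\<^sup>4) \<psi>(q^12)\<close> generates \<open>t(1,3,4,12;n)\<close>.

  The logarithmic derivative of \<open>\<Sum> z^n q^(n\<^sup>2)\<close> in \<open>z\<close> is a Lambert series. Taking it at \<open>\<plusminus>\<omega>\<close>, for a
  primitive cube root of unity \<open>\<omega>\<close>, and evaluating the resulting Wronskian by the Jacobi triple
  product gives \<open>q \<psi>(q\<^sup>2) \<psi>(q\<^sup>6) = \<Sum> \<chi>(d) q^(d x)\<close> over odd \<open>d, x\<close>, where \<open>\<chi>\<close> is the nontrivial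
  character modulo 3. Since \<open>\<chi>(d) \<chi>(e) = [3 dvd d - e] - [3 dvd d + e]\<close>, Liouville's identity for
  \<open>d x + e y = 2 N\<close> in odd numbers, \<open>N\<close> odd, shows that the coefficient of \<open>q^(2N)\<close> in the square of
  this series is the sum of the divisors of \<open>N\<close> prime to 3.

  On the other hand, \<open>\<psi>(x)\<^sup>2 = \<phi>(x) \<psi>(x\<^sup>2)\<close> and the 2-dissections of \<open>\<phi>(x) \<phi>(x\<^sup>3)\<close> show that the even
  part of \<open>\<psi>(x)\<^sup>2 \<psi>(x\<^sup>3)\<^sup>2\<close> is, with \<open>Q = x\<^sup>2\<close>,
  \<open>\<psi>(Q) \<psi>(Q\<^sup>3) (\<phi>(-Q\<^sup>2) \<phi>(-Q\<^sup>6) + 8 Q\<^sup>2 \<psi>(Q\<^sup>4) \<psi>(Q^12))\<close>, and by the product formulas the first summand is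
  the given eta product at \<open>\<i> x\<close>, up to the factor \<open>\<i> x\<close>.
\<close>

section \<open>Sums over triangular numbers\<close>

text \<open>Defined on all integers, because the series below are two-sided;
  \<open>n * (n + 1)\<close> is never negative, so \<open>nat\<close> truncates nothing. Each
  triangular number is taken twice, at \<open>n\<close> and at \<open>- 1 - n\<close>.\<close>

definition tri :: "int \<Rightarrow> nat" where
  "tri n = nat (n * (n + 1) div 2)"

lemma two_tri: "2 * int (tri n) = n * (n + 1)"
proof -
  have "n * (n + 1) \<ge> 0"
    by (cases "n \<ge> 0") (auto intro: mult_nonpos_nonpos)
  moreover have "even (n * (n + 1))" by simp
  ultimately show ?thesis by (simp add: tri_def)
qed

lemma tri_shift: "int (tri (n + 1)) = int (tri n) + n + 1"
  using two_tri[of n] two_tri[of "n + 1"] by (simp add: algebra_simps)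

lemma tri_reflect: "tri (- 1 - n) = tri n"
  using two_tri[of n] two_tri[of "- 1 - n"] by (simp add: algebra_simps)

lemma tri_Suc: "tri (int (Suc k)) = tri (int k) + Suc k"
  using tri_shift[of "int k"] by (simp add: algebra_simps)

lemma power_tri_shift:
  fixes p :: "'a :: field"
  assumes "p \<noteq> 0"
  shows "p ^ tri (n + 1) = p ^ tri n * p powi (n + 1)"
proof -
  have "p ^ tri (n + 1) = p powi (int (tri n) + (n + 1))"
    by (metis power_int_of_nat tri_shift add.assoc)
  thus ?thesis using assms by (simp add: power_int_add)
qed

text \<open>Consecutive terms have quotient at most \<open>2 * c * r ^ Suc k\<close>, which tends to
  0 however large \<open>c\<close> is. The weight \<open>1 + real k\<close> covers both plain theta
  sums and those weighted by the index.\<close>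

lemma summable_tri_nat:
  fixes c r :: real
  assumes "c > 0" "0 \<le> r" "r < 1"
  shows "summable (\<lambda>k. (1 + real k) * c ^ k * r ^ tri (int k))"
proof -
  have "(\<lambda>k. 2 * c * r ^ Suc k) \<longlonglongrightarrow> 2 * c * 0"
    using assms by (intro tendsto_intros LIMSEQ_Suc LIMSEQ_power_zero) auto
  hence "\<forall>\<^sub>F k in sequentially. 2 * c * r ^ Suc k < 1/2"
    by (intro order_tendstoD(2)) auto
  then obtain N where N: "\<And>k. k \<ge> N \<Longrightarrow> 2 * c * r ^ Suc k < 1/2"
    unfolding eventually_sequentially by blast
  show ?thesis
  proof (rule summable_ratio_test[of "1/2" N])
    fix k assume k: "k \<ge> N"
    let ?a = "\<lambda>k. (1 + real k) * c ^ k * r ^ tri (int k)"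
    have a: "?a k \<ge> 0" using assms by auto
    have "?a (Suc k) = (2 + real k) * (c ^ k * r ^ tri (int k)) * (c * r ^ Suc k)"
      unfolding tri_Suc by (simp add: power_add algebra_simps)
    also have "\<dots> \<le> (2 * (1 + real k)) * (c ^ k * r ^ tri (int k)) * (c * r ^ Suc k)"
      using assms by (intro mult_right_mono) auto
    also have "\<dots> = ?a k * (2 * c * r ^ Suc k)" by (simp add: algebra_simps)
    also have "\<dots> \<le> ?a k * (1/2)"
      using a N[OF k] by (intro mult_left_mono) auto
    finally show "norm (?a (Suc k)) \<le> 1/2 * norm (?a k)"
      using assms by (simp add: abs_mult)
  qed auto
qed

text \<open>The negative half is folded onto the nonnegative one by sending \<open>n\<close> to
  \<open>- 1 - n\<close>, which fixes \<open>tri n\<close> and replaces \<open>c\<close> by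
  \<open>1 / c\<close> up to constant factors.\<close>

lemma summable_tri:
  fixes c r :: real
  assumes "c > 0" "0 \<le> r" "r < 1"
  shows "(\<lambda>n. (1 + \<bar>of_int n\<bar>) * c powi n * r ^ tri n) summable_on UNIV" (is "?f summable_on _")
proof -
  have pos: "?f summable_on range int"
    using summable_tri_nat[OF assms] assms
    by (subst summable_on_reindex) (auto simp: o_def summable_on_UNIV_nonneg_real_iff)
  have "(\<lambda>k. (2 + real k) * c powi (- 1 - int k) * r ^ tri (int k)) summable_on UNIV"
  proof (rule summable_on_comparison_test)
    have "summable (\<lambda>k. (2 / c) * ((1 + real k) * (1 / c) ^ k * r ^ tri (int k)))"
      using assms by (intro summable_mult summable_tri_nat) auto
    thus "(\<lambda>k. (2 / c) * ((1 + real k) * (1 / c) ^ k * r ^ tri (int k))) summable_on UNIV"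
      using assms by (subst summable_on_UNIV_nonneg_real_iff) auto
    fix k
    have "c powi (- 1 - int k) = (1 / c) * (1 / c) ^ k"
      using assms by (simp add: power_int_diff power_int_minus power_one_over field_simps)
    moreover have "(2 + real k) * ((1 / c) * (1 / c) ^ k * r ^ tri (int k))
        \<le> (2 * (1 + real k)) * ((1 / c) * (1 / c) ^ k * r ^ tri (int k))"
      using assms by (intro mult_right_mono) auto
    ultimately show "(2 + real k) * c powi (- 1 - int k) * r ^ tri (int k)
        \<le> (2 / c) * ((1 + real k) * (1 / c) ^ k * r ^ tri (int k))"
      by (simp add: algebra_simps add_divide_distrib)
  qed (use assms in auto)
  also have "?this \<longleftrightarrow> (?f \<circ> (\<lambda>k. - 1 - int k)) summable_on UNIV"
    by (intro summable_on_cong) (simp add: tri_reflect)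
  finally have neg: "?f summable_on range (\<lambda>k. - 1 - int k)"
    by (subst summable_on_reindex) (auto intro: inj_onI)
  have "UNIV = range int \<union> range (\<lambda>k. - 1 - int k)"
  proof (intro set_eqI iffI)
    fix n :: int
    show "n \<in> range int \<union> range (\<lambda>k. - 1 - int k)"
    proof (cases "n \<ge> 0")
      case True
      thus ?thesis by (auto intro: image_eqI[of _ _ "nat n"])
    next
      case False
      hence "n \<in> range (\<lambda>k. - 1 - int k)" by (intro image_eqI[of _ _ "nat (- 1 - n)"]) auto
      thus ?thesis by blast
    qed
  qed auto
  thus ?thesis using summable_on_union[OF pos neg] by simp
qed

lemma abs_summable_tri:
  fixes z p :: complex
  assumes "z \<noteq> 0" "norm p < 1"
  shows "(\<lambda>n. norm (of_int n * z powi n * p ^ tri n)) summable_on UNIV"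
    and "(\<lambda>n. norm (z powi n * p ^ tri n)) summable_on UNIV"
proof -
  have S: "(\<lambda>n. (1 + \<bar>of_int n\<bar>) * norm z powi n * norm p ^ tri n) summable_on UNIV"
    using assms by (intro summable_tri) auto
  show "(\<lambda>n. norm (of_int n * z powi n * p ^ tri n)) summable_on UNIV"
    by (rule Infinite_Sum.abs_summable_on_comparison_test'[OF S])
       (auto simp: norm_mult norm_power norm_power_int intro!: mult_right_mono)
  show "(\<lambda>n. norm (z powi n * p ^ tri n)) summable_on UNIV"
  proof (rule Infinite_Sum.abs_summable_on_comparison_test'[OF S])
    fix n
    have "1 * (norm z powi n * norm p ^ tri n) \<le> (1 + \<bar>of_int n\<bar>) * (norm z powi n * norm p ^ tri n)"
      by (intro mult_right_mono) auto
    thus "norm (z powi n * p ^ tri n) \<le> (1 + \<bar>of_int n\<bar>) * norm z powi n * norm p ^ tri n"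
      by (simp add: norm_mult norm_power norm_power_int mult.assoc)
  qed
qed

text \<open>Dominated convergence for two-sided series: Tannery's theorem, transported along the
  bijection \<open>int_decode\<close>. It carries the finite product identities over to the infinite
  ones.\<close>

lemma has_sum_int_dominated:
  fixes f :: "nat \<Rightarrow> int \<Rightarrow> 'a :: {real_normed_algebra, banach}"
  assumes "\<And>m. (f m has_sum F m) UNIV" "(g has_sum G) UNIV"
    and "\<And>n. (\<lambda>m. f m n) \<longlonglongrightarrow> g n"
    and "\<And>m n. norm (f m n) \<le> M n" "M summable_on UNIV"
  shows "F \<longlonglongrightarrow> G"
proof -
  let ?d = int_decode
  have "M \<circ> ?d summable_on UNIV"
    using assms(5) summable_on_reindex[of ?d UNIV M] by (simp add: surj_int_decode inj_int_decode)
  hence "summable (M \<circ> ?d)" by (rule summable_on_imp_summable)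
  hence "(\<lambda>m. \<Sum>k. f m (?d k)) \<longlonglongrightarrow> (\<Sum>k. g (?d k))"
    using tannerys_theorem[of "\<lambda>k m. f m (?d k)" "\<lambda>k. g (?d k)" sequentially "M \<circ> ?d"] assms(3,4)
    by (simp add: case_prod_unfold)
  moreover have "(\<Sum>k. f m (?d k)) = F m" for m
    using assms(1)[of m] has_sum_reindex_bij_betw[OF bij_int_decode, of "f m"]
    by (intro sums_unique[symmetric] has_sum_imp_sums) simp
  moreover have "(\<Sum>k. g (?d k)) = G"
    using assms(2) has_sum_reindex_bij_betw[OF bij_int_decode, of g]
    by (intro sums_unique[symmetric] has_sum_imp_sums) simp
  ultimately show ?thesis by simp
qed

section \<open>The Jacobi triple product\<close>

lemma convergent_prod_geometric:
  fixes c q :: complex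
  assumes "norm q < 1"
  shows "convergent_prod (\<lambda>k. 1 - c * q ^ k)"
proof -
  have "summable (\<lambda>k. norm c * norm q ^ k)"
    using assms by (intro summable_mult summable_geometric) auto
  hence "summable (\<lambda>k. norm (1 - c * q ^ k - 1))" by (simp add: norm_mult norm_power)
  thus ?thesis
    by (intro abs_convergent_prod_imp_convergent_prod summable_imp_abs_convergent_prod)
qed

text \<open>In q-series notation this is (q; q)_infinity, and \<open>odd_euler_prod\<close> is (q;
  q^2)_infinity. The special theta values below are expressed through these two.\<close>

definition euler_prod :: "complex \<Rightarrow> complex" where
  "euler_prod q = (\<Prod>k. 1 - q ^ Suc k)"

definition odd_euler_prod :: "complex \<Rightarrow> complex" where
  "odd_euler_prod q = (\<Prod>k. 1 - q ^ (2 * k + 1))"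

lemma convergent_euler_prod: "norm q < 1 \<Longrightarrow> convergent_prod (\<lambda>k. 1 - q ^ Suc k :: complex)"
  using convergent_prod_geometric[of q q] by simp

lemma convergent_odd_euler_prod:
  "norm q < 1 \<Longrightarrow> convergent_prod (\<lambda>k. 1 - q ^ (2 * k + 1) :: complex)"
  using convergent_prod_geometric[of "q\<^sup>2" q]
  by (simp add: norm_power power_mult power_less_one_iff)

lemma one_minus_power_nonzero:
  fixes q :: "'a :: real_normed_field"
  assumes "norm q < 1" "k > 0"
  shows "1 - q ^ k \<noteq> 0"
proof
  assume "1 - q ^ k = 0"
  hence "norm q ^ k = 1" by (metis eq_iff_diff_eq_0 norm_one norm_power)
  moreover have "norm q ^ k < 1" using assms by (simp add: power_less_one_iff)
  ultimately show False by simp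
qed

lemma euler_prod_nonzero: "norm q < 1 \<Longrightarrow> euler_prod q \<noteq> 0"
  unfolding euler_prod_def
  by (intro prodinf_nonzero convergent_euler_prod one_minus_power_nonzero) auto

lemma odd_euler_prod_nonzero: "norm q < 1 \<Longrightarrow> odd_euler_prod q \<noteq> 0"
  unfolding odd_euler_prod_def
  by (intro prodinf_nonzero convergent_odd_euler_prod one_minus_power_nonzero) auto

section \<open>Gaussian binomial coefficients and the finite triple product\<close>

definition qfact :: "complex \<Rightarrow> nat \<Rightarrow> complex" where
  "qfact p m = (\<Prod>k<m. 1 - p ^ Suc k)"

lemma qfact_0 [simp]: "qfact p 0 = 1"
  and qfact_Suc: "qfact p (Suc m) = qfact p m * (1 - p ^ Suc m)"
  by (simp_all add: qfact_def)

lemma qfact_nonzero: "norm p < 1 \<Longrightarrow> qfact p m \<noteq> 0"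
  unfolding qfact_def using one_minus_power_nonzero[of p] by (auto simp del: power_Suc)

lemma qfact_tendsto: "norm p < 1 \<Longrightarrow> qfact p \<longlonglongrightarrow> euler_prod p"
  using convergent_prod_LIMSEQ[OF convergent_euler_prod[of p]]
  unfolding qfact_def[abs_def] euler_prod_def by (simp only: LIMSEQ_lessThan_iff_atMost)

definition inv_qfact :: "complex \<Rightarrow> int \<Rightarrow> complex" where
  "inv_qfact p k = (if k < 0 then 0 else inverse (qfact p (nat k)))"

text \<open>The convention that \<open>1 / (p; p)\<^sub>k\<close> vanishes for \<open>k < 0\<close> makes this recurrence valid for all \<open>k\<close>.\<close>

lemma inv_qfact_rec:
  assumes "norm p < 1"
  shows "inv_qfact p (k - 1) = inv_qfact p k * (1 - p powi k)"
proof (cases "k > 0")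
  case True
  then obtain j where j: "k = int (Suc j)" by (metis zero_less_imp_eq_int gr0_implies_Suc of_nat_0_less_iff)
  have "1 - p ^ Suc j \<noteq> 0" by (intro one_minus_power_nonzero assms) auto
  moreover have "qfact p j \<noteq> 0" by (intro qfact_nonzero assms)
  moreover have "p powi k = p ^ Suc j" unfolding j by (rule power_int_of_nat)
  moreover have "nat k = Suc j" "nat (k - 1) = j" using j by auto
  ultimately show ?thesis using True
    by (simp add: inv_qfact_def qfact_Suc del: power_Suc)
qed (auto simp: inv_qfact_def)

text \<open>The Gaussian binomial coefficient of \<open>2 * m\<close> over \<open>m + n\<close>. The
  bottom entry is centred, so \<open>n\<close> runs over all integers and the value is 0 outside
  -m..m.\<close>

definition qbinom :: "complex \<Rightarrow> nat \<Rightarrow> int \<Rightarrow> complex" where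
  "qbinom p m n = qfact p (2 * m) * inv_qfact p (int m + n) * inv_qfact p (int m - n)"

lemma qbinom_0: "qbinom p 0 n = (if n = 0 then 1 else 0)"
  by (auto simp: qbinom_def inv_qfact_def)

text \<open>This is the q-Pascal rule applied twice. With \<open>u\<close> and \<open>v\<close> the
  reciprocals at the largest indices, all terms become polynomial multiples of
  \<open>qfact p (2 * m) * u * v\<close>, and a polynomial identity in \<open>p\<close>,
  \<open>A\<close>, \<open>B\<close> remains.\<close>

lemma qbinom_Suc:
  assumes "norm p < 1" "p \<noteq> 0"
  shows "qbinom p (Suc m) n = (1 + p ^ (2 * m + 1)) * qbinom p m n
           + p powi (int m + 1 - n) * qbinom p m (n - 1)
           + p powi (int m + n + 1) * qbinom p m (n + 1)"
proof -
  define u v A B where "u = inv_qfact p (int m + n + 1)" and "v = inv_qfact p (int m - n + 1)"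
    and "A = p powi (int m + n)" and "B = p powi (int m - n)"
  note rec = inv_qfact_rec[OF assms(1)]
  have pA: "p powi (int m + n + 1) = p * A" and pB: "p powi (int m - n + 1) = p * B"
    using assms by (simp_all add: A_def B_def power_int_add_1')
  have "A * B = p powi (int (2 * m))" using assms by (simp add: A_def B_def flip: power_int_add)
  hence AB: "p ^ (2 * m) = A * B" by (simp only: power_int_of_nat)
  have u: "inv_qfact p (int m + n) = u * (1 - p * A)"
    using rec[of "int m + n + 1"] pA by (simp add: u_def)
  have u': "inv_qfact p (int m + n - 1) = u * (1 - p * A) * (1 - A)"
    using rec[of "int m + n"] u by (simp add: A_def)
  have v: "inv_qfact p (int m - n) = v * (1 - p * B)"
    using rec[of "int m - n + 1"] pB by (simp add: v_def)
  have v': "inv_qfact p (int m - n - 1) = v * (1 - p * B) * (1 - B)"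
    using rec[of "int m - n"] v by (simp add: B_def)
  have q: "qfact p (2 * Suc m) = qfact p (2 * m) * (1 - p * (A * B)) * (1 - p\<^sup>2 * (A * B))"
    by (simp add: qfact_Suc power2_eq_square flip: AB)
  have "qbinom p (Suc m) n = qfact p (2 * m) * (1 - p * (A * B)) * (1 - p\<^sup>2 * (A * B)) * u * v"
    unfolding qbinom_def q by (simp add: u_def v_def algebra_simps)
  moreover have "qbinom p m n = qfact p (2 * m) * (u * (1 - p * A)) * (v * (1 - p * B))"
    unfolding qbinom_def u v ..
  moreover have "qbinom p m (n - 1) = qfact p (2 * m) * (u * (1 - p * A) * (1 - A)) * v"
  proof -
    have "int m + (n - 1) = int m + n - 1" "int m - (n - 1) = int m - n + 1" by simp_all
    thus ?thesis unfolding qbinom_def by (simp only: u' v_def)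
  qed
  moreover have "qbinom p m (n + 1) = qfact p (2 * m) * u * (v * (1 - p * B) * (1 - B))"
  proof -
    have "int m + (n + 1) = int m + n + 1" "int m - (n + 1) = int m - n - 1" by simp_all
    thus ?thesis unfolding qbinom_def by (simp only: v' u_def)
  qed
  moreover have "p powi (int m + 1 - n) = p * B" "p ^ (2 * m + 1) = p * (A * B)"
    using pB by (simp_all add: algebra_simps flip: AB)
  moreover have "Q * (1 - p * (A * B)) * (1 - p\<^sup>2 * (A * B)) * u * v
      = (1 + p * (A * B)) * (Q * (u * (1 - p * A)) * (v * (1 - p * B)))
        + p * B * (Q * (u * (1 - p * A) * (1 - A)) * v)
        + p * A * (Q * u * (v * (1 - p * B) * (1 - B)))" for Q
  proof -
    have "(1 - p * (A * B)) * (1 - p\<^sup>2 * (A * B))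
        = (1 + p * (A * B)) * ((1 - p * A) * (1 - p * B))
          + p * B * ((1 - p * A) * (1 - A)) + p * A * ((1 - p * B) * (1 - B))"
      by (simp add: algebra_simps power2_eq_square)
    hence "Q * u * v * ((1 - p * (A * B)) * (1 - p\<^sup>2 * (A * B)))
        = Q * u * v * ((1 + p * (A * B)) * ((1 - p * A) * (1 - p * B)))
          + Q * u * v * (p * B * ((1 - p * A) * (1 - A)))
          + Q * u * v * (p * A * ((1 - p * B) * (1 - B)))"
      by (simp only: distrib_left)
    thus ?thesis by (simp only: mult_ac)
  qed
  ultimately show ?thesis by (simp only: pA)
qed

text \<open>General term of the series side of the Jacobi triple product. The base is
  \<open>- z\<close>, so that the product side has factors of the form 1 - z p^k.\<close>

definition jacobi_coeff :: "complex \<Rightarrow> complex \<Rightarrow> int \<Rightarrow> complex" where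
  "jacobi_coeff z p n = (- z) powi n * p ^ tri n"

lemma jacobi_coeff_shift:
  assumes "p \<noteq> 0" "z \<noteq> 0"
  shows "jacobi_coeff z p (n + 1) = - z * p powi (n + 1) * jacobi_coeff z p n"
  using assms by (simp add: jacobi_coeff_def power_tri_shift power_int_add_1)

text \<open>The weights in \<open>qbinom_Suc\<close> depend on \<open>n\<close>. The factor
  \<open>jacobi_coeff\<close> absorbs exactly this dependence, so the recurrence gets constant
  coefficients and can be summed over \<open>n\<close>.\<close>

lemma jacobi_qbinom_Suc:
  assumes "norm p < 1" "p \<noteq> 0" "z \<noteq> 0"
  shows "jacobi_coeff z p n * qbinom p (Suc m) n
       = (1 + p ^ (2 * m + 1)) * (jacobi_coeff z p n * qbinom p m n)
         - z * p ^ Suc m * (jacobi_coeff z p (n - 1) * qbinom p m (n - 1))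
         - p ^ m / z * (jacobi_coeff z p (n + 1) * qbinom p m (n + 1))"
proof -
  have "p powi (int m + 1 - n) = p ^ Suc m / p powi n"
    using assms by (simp add: power_int_diff power_int_add_1')
  moreover have "p powi (int m + n + 1) = p ^ m * p powi (n + 1)"
    using assms by (simp add: power_int_add add.assoc)
  moreover have "jacobi_coeff z p n = - z * p powi n * jacobi_coeff z p (n - 1)"
    using jacobi_coeff_shift[OF assms(2,3), of "n - 1"] by simp
  ultimately show ?thesis
    using assms unfolding qbinom_Suc[OF assms(1,2)] jacobi_coeff_shift[OF assms(2,3)]
    by (simp add: field_simps)
qed

lemma has_sum_diff:
  fixes f g :: "'a \<Rightarrow> 'b :: real_normed_algebra_1"
  assumes "(f has_sum a) A" "(g has_sum b) A"
  shows "((\<lambda>x. f x - g x) has_sum (a - b)) A"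
  using has_sum_add[OF assms(1) has_sum_uminusI[OF assms(2)]] by simp

lemma has_sum_int_shift:
  assumes "(f has_sum S) UNIV"
  shows "((\<lambda>n :: int. f (n + a)) has_sum S) UNIV"
  using assms by (subst has_sum_reindex_bij_witness[of _ "\<lambda>n. n - a" "\<lambda>n. n + a" UNIV f]) auto

text \<open>Induction on \<open>m\<close>: a sum over all integers is invariant under shifts, so the
  recurrence multiplies it by \<open>1 + p ^ (2 * m + 1) - z * p ^ Suc m - p ^ m / z\<close>, which
  splits into the two new factors of the product.\<close>

lemma finite_jacobi_triple:
  assumes "norm p < 1" "p \<noteq> 0" "z \<noteq> 0"
  shows "((\<lambda>n. jacobi_coeff z p n * qbinom p m n)
           has_sum (\<Prod>k<m. (1 - z * p ^ Suc k) * (1 - p ^ k / z))) UNIV"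
proof (induction m)
  case 0
  show ?case
    by (rule has_sum_finite_neutralI[of "{0}"]) (auto simp: qbinom_0 jacobi_coeff_def tri_def)
next
  case (Suc m)
  let ?f = "\<lambda>n. jacobi_coeff z p n * qbinom p m n"
  let ?F = "\<Prod>k<m. (1 - z * p ^ Suc k) * (1 - p ^ k / z)"
  have "((\<lambda>n. (1 + p ^ (2 * m + 1)) * ?f n - z * p ^ Suc m * ?f (n + (- 1)) - p ^ m / z * ?f (n + 1))
          has_sum ((1 + p ^ (2 * m + 1)) * ?F - z * p ^ Suc m * ?F - p ^ m / z * ?F)) UNIV"
    by (intro has_sum_diff has_sum_cmult_right Suc has_sum_int_shift[OF Suc])
  also have "(1 + p ^ (2 * m + 1)) * ?F - z * p ^ Suc m * ?F - p ^ m / z * ?F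
      = ?F * ((1 - z * p ^ Suc m) * (1 - p ^ m / z))"
  proof -
    have "(1 + p ^ (2 * m + 1)) - z * p ^ Suc m - p ^ m / z = (1 - z * p ^ Suc m) * (1 - p ^ m / z)"
      using assms by (simp add: field_simps power_add mult_2 mult_2_right)
    thus ?thesis by (simp only: left_diff_distrib[symmetric] mult.commute[of ?F])
  qed
  finally show ?case using jacobi_qbinom_Suc[OF assms] by simp
qed

text \<open>The derivative at \<open>z = 1\<close> of the finite triple product, obtained from the same recurrence.\<close>

lemma finite_jacobi_cube:
  assumes "norm p < 1" "p \<noteq> 0"
  shows "((\<lambda>n. of_int n * (jacobi_coeff 1 p n * qbinom p (Suc m) n))
           has_sum (qfact p (Suc m) * qfact p m)) UNIV"
proof -
  let ?c = "jacobi_coeff 1 p"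
  \<comment> \<open>A shift of the index by one changes the weight \<open>n\<close> by one; this
    brings the unweighted sum \<open>F\<close> into the recurrence for the weighted sum
    \<open>H\<close>.\<close>
  have step: "((\<lambda>n. of_int n * (?c n * qbinom p (Suc m) n)) has_sum
      ((1 + p ^ (2 * m + 1)) * H - p ^ Suc m * (H + F) - p ^ m * (H - F))) UNIV"
    if H: "((\<lambda>n. of_int n * (?c n * qbinom p m n)) has_sum H) UNIV"
      and F: "((\<lambda>n. ?c n * qbinom p m n) has_sum F) UNIV" for H F m
  proof -
    have "((\<lambda>n. (1 + p ^ (2 * m + 1)) * (of_int n * (?c n * qbinom p m n))
        - p ^ Suc m * (of_int (n + (- 1)) * (?c (n + (- 1)) * qbinom p m (n + (- 1)))
                        + ?c (n + (- 1)) * qbinom p m (n + (- 1)))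
        - p ^ m * (of_int (n + 1) * (?c (n + 1) * qbinom p m (n + 1))
                        - ?c (n + 1) * qbinom p m (n + 1)))
        has_sum ((1 + p ^ (2 * m + 1)) * H - p ^ Suc m * (H + F) - p ^ m * (H - F))) UNIV"
      by (intro has_sum_diff has_sum_add has_sum_cmult_right H has_sum_int_shift[OF H]
            has_sum_int_shift[OF F])
    moreover have "(1 + p ^ (2 * m + 1)) * (of_int n * (?c n * qbinom p m n))
        - p ^ Suc m * (of_int (n + (- 1)) * (?c (n + (- 1)) * qbinom p m (n + (- 1)))
                        + ?c (n + (- 1)) * qbinom p m (n + (- 1)))
        - p ^ m * (of_int (n + 1) * (?c (n + 1) * qbinom p m (n + 1))
                        - ?c (n + 1) * qbinom p m (n + 1))
        = of_int n * (?c n * qbinom p (Suc m) n)" for n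
    proof -
      have "(1 + P) * (x * a) - Q * (of_int (n + (- 1)) * b + b) - R * (of_int (n + 1) * d - d)
          = x * ((1 + P) * a - Q * b - R * d)" if "x = of_int n" for P Q R a b d x :: complex
        using that by (simp add: algebra_simps)
      from this[OF refl] show ?thesis unfolding jacobi_qbinom_Suc[OF assms one_neq_zero] by simp
    qed
    ultimately show ?thesis by (simp only:)
  qed
  \<comment> \<open>At z = 1 the factor for k = 0 contains 1 - p^0 = 0. Hence the unweighted sum
    contributes only to the very first step, where the product is empty and equals 1.\<close>
  have F: "((\<lambda>n. ?c n * qbinom p (Suc m) n) has_sum 0) UNIV" for m
    using finite_jacobi_triple[OF assms one_neq_zero, of "Suc m"]
    by (simp add: prod.lessThan_Suc_shift del: prod.lessThan_Suc)
  show ?thesis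
  proof (induction m)
    case 0
    have "((\<lambda>n. of_int n * (?c n * qbinom p 0 n)) has_sum 0) UNIV"
      by (rule has_sum_finite_neutralI[of "{0}"]) (auto simp: qbinom_0)
    from step[OF this finite_jacobi_triple[OF assms one_neq_zero, of 0]]
    show ?case by (simp add: qfact_Suc)
  next
    case (Suc m)
    let ?H = "qfact p (Suc m) * qfact p m"
    have "(1 + p ^ (2 * Suc m + 1)) - p ^ Suc (Suc m) - p ^ Suc m = (1 - p ^ Suc m) * (1 - p ^ Suc (Suc m))"
      by (simp add: algebra_simps power_add mult_2 mult_2_right)
    hence "(1 + p ^ (2 * Suc m + 1)) * ?H - p ^ Suc (Suc m) * ?H - p ^ Suc m * ?H
        = (1 - p ^ Suc m) * (1 - p ^ Suc (Suc m)) * ?H"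
      by (simp only: left_diff_distrib[symmetric])
    also have "\<dots> = qfact p (Suc (Suc m)) * qfact p (Suc m)"
      unfolding qfact_Suc[of p "Suc m"] qfact_Suc[of p m] by (simp only: mult_ac)
    finally show ?case using step[OF Suc F] by (simp only: add_0_right diff_0_right)
  qed
qed

section \<open>Passage to the limit in the finite identities\<close>

lemma qbinom_tendsto:
  assumes "norm p < 1"
  shows "(\<lambda>m. qbinom p m n) \<longlonglongrightarrow> inverse (euler_prod p)"
proof -
  have inv: "(\<lambda>m. inv_qfact p (int m + k)) \<longlonglongrightarrow> inverse (euler_prod p)" for k
  proof -
    have "(\<lambda>m. inverse (qfact p m)) \<longlonglongrightarrow> inverse (euler_prod p)"
      by (intro tendsto_inverse qfact_tendsto euler_prod_nonzero assms)
    moreover have "filterlim (\<lambda>m. nat (int m + k)) sequentially sequentially"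
      unfolding filterlim_at_top eventually_sequentially
    proof
      fix Z
      show "\<exists>N. \<forall>m\<ge>N. Z \<le> nat (int m + k)" by (intro exI[of _ "Z + nat (- k)"]) auto
    qed
    ultimately have "(\<lambda>m. inverse (qfact p (nat (int m + k)))) \<longlonglongrightarrow> inverse (euler_prod p)"
      by (rule filterlim_compose)
    moreover have "\<forall>\<^sub>F m in sequentially. inverse (qfact p (nat (int m + k))) = inv_qfact p (int m + k)"
      using eventually_ge_at_top[of "nat (- k)"] by eventually_elim (auto simp: inv_qfact_def)
    ultimately show ?thesis by (rule Lim_transform_eventually)
  qed
  have "(\<lambda>m. qfact p (2 * m)) \<longlonglongrightarrow> euler_prod p"
    using LIMSEQ_subseq_LIMSEQ[OF qfact_tendsto[OF assms], of "\<lambda>m. 2 * m"]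
    by (simp add: o_def strict_mono_def)
  from tendsto_mult[OF tendsto_mult[OF this inv[of n]] inv[of "- n"]]
  show ?thesis using euler_prod_nonzero[OF assms] unfolding qbinom_def by simp
qed

text \<open>Convergent sequences are bounded. The bound is uniform in \<open>m\<close> and
  \<open>n\<close>, as the majorants in the two limits below require.\<close>

lemma qbinom_bounded:
  assumes "norm p < 1"
  obtains C where "\<And>m n. norm (qbinom p m n) \<le> C"
proof -
  have "Bseq (qfact p)"
    using qfact_tendsto[OF assms] by (intro convergent_imp_Bseq convergentI)
  then obtain K where K: "K > 0" "\<And>m. norm (qfact p m) \<le> K" by (auto elim: BseqE)
  have "Bseq (\<lambda>m. inverse (qfact p m))"
    using tendsto_inverse[OF qfact_tendsto euler_prod_nonzero] assms
    by (intro convergent_imp_Bseq convergentI)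
  then obtain L where L: "L > 0" "\<And>m. norm (inverse (qfact p m)) \<le> L" by (auto elim: BseqE)
  have inv: "norm (inv_qfact p k) \<le> L" for k
    using L by (auto simp: inv_qfact_def)
  have "norm (qbinom p m n) \<le> K * L * L" for m n
    unfolding qbinom_def norm_mult using K L inv by (intro mult_mono) auto
  thus ?thesis using that by blast
qed

lemma summable_jacobi:
  assumes "norm p < 1" "z \<noteq> 0"
  shows "(\<lambda>n. norm (of_int n * jacobi_coeff z p n)) summable_on UNIV"
    and "(\<lambda>n. norm (jacobi_coeff z p n)) summable_on UNIV"
  using abs_summable_tri[of "- z" p] assms by (simp_all add: jacobi_coeff_def mult.assoc)

text \<open>The limit of \<open>finite_jacobi_triple\<close>: every Gaussian binomial tends to
  \<open>inverse (euler_prod p)\<close>, and the summable theta terms times the uniform bound form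
  the majorant.\<close>

theorem jacobi_triple_product:
  assumes "norm p < 1" "p \<noteq> 0" "z \<noteq> 0"
  shows "(\<lambda>m. \<Prod>k<m. (1 - z * p ^ Suc k) * (1 - p ^ k / z))
           \<longlonglongrightarrow> (\<Sum>\<^sub>\<infinity>n. jacobi_coeff z p n) / euler_prod p"
proof -
  obtain C where C: "\<And>m n. norm (qbinom p m n) \<le> C" using qbinom_bounded assms(1) by blast
  note S = summable_jacobi(2)[OF assms(1,3)]
  have G: "((\<lambda>n. jacobi_coeff z p n * inverse (euler_prod p))
         has_sum ((\<Sum>\<^sub>\<infinity>n. jacobi_coeff z p n) * inverse (euler_prod p))) UNIV"
    by (intro has_sum_cmult_left has_sum_infsum abs_summable_summable[OF S])
  show ?thesis unfolding divide_inverse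
  proof (rule has_sum_int_dominated[OF finite_jacobi_triple[OF assms, unfolded divide_inverse] G])
    show "(\<lambda>n. norm (jacobi_coeff z p n) * C) summable_on UNIV"
      by (intro summable_on_cmult_left S)
  qed (auto simp: norm_mult intro!: tendsto_intros qbinom_tendsto assms mult_left_mono C)
qed

text \<open>The limit of \<open>finite_jacobi_cube\<close>: its value tends to
  \<open>euler_prod p * euler_prod p\<close>, and the inverse Euler product coming from the
  binomials supplies the third factor.\<close>

theorem jacobi_cube:
  assumes "norm p < 1" "p \<noteq> 0"
  shows "(\<Sum>\<^sub>\<infinity>n. of_int n * jacobi_coeff 1 p n) = euler_prod p ^ 3"
proof -
  obtain C where C: "\<And>m n. norm (qbinom p m n) \<le> C" using qbinom_bounded assms(1) by blast
  let ?a = "\<lambda>n. of_int n * jacobi_coeff 1 p n"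
  note S = summable_jacobi(1)[OF assms(1) one_neq_zero]
  have G: "((\<lambda>n. ?a n * inverse (euler_prod p)) has_sum (infsum ?a UNIV * inverse (euler_prod p))) UNIV"
    by (intro has_sum_cmult_left has_sum_infsum abs_summable_summable[OF S])
  have F: "((\<lambda>n. ?a n * qbinom p (Suc m) n) has_sum (qfact p (Suc m) * qfact p m)) UNIV" for m
    using finite_jacobi_cube[OF assms] by (simp add: mult.assoc)
  have "(\<lambda>m. qfact p (Suc m) * qfact p m) \<longlonglongrightarrow> infsum ?a UNIV * inverse (euler_prod p)"
  proof (rule has_sum_int_dominated[OF F G])
    show "(\<lambda>n. norm (?a n) * C) summable_on UNIV"
      by (intro summable_on_cmult_left S)
  qed (auto simp: norm_mult intro!: tendsto_intros LIMSEQ_Suc[OF qbinom_tendsto] assms mult_left_mono C)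
  moreover have "(\<lambda>m. qfact p (Suc m) * qfact p m) \<longlonglongrightarrow> euler_prod p * euler_prod p"
    by (intro tendsto_intros LIMSEQ_Suc qfact_tendsto assms)
  ultimately have "infsum ?a UNIV * inverse (euler_prod p) = euler_prod p * euler_prod p"
    by (rule LIMSEQ_unique)
  thus ?thesis using euler_prod_nonzero[OF assms(1)] by (simp add: field_simps power3_eq_cube)
qed

section \<open>Ramanujan's theta functions as products\<close>

lemma euler_prod_has_prod: "norm q < 1 \<Longrightarrow> (\<lambda>k. 1 - q ^ Suc k) has_prod euler_prod q"
  unfolding euler_prod_def by (intro convergent_prod_has_prod convergent_euler_prod)

lemma odd_euler_prod_has_prod: "norm q < 1 \<Longrightarrow> (\<lambda>k. 1 - q ^ (2 * k + 1)) has_prod odd_euler_prod q"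
  unfolding odd_euler_prod_def by (intro convergent_prod_has_prod convergent_odd_euler_prod)

lemma norm_power_less_one:
  fixes q :: "'a :: real_normed_div_algebra"
  shows "norm q < 1 \<Longrightarrow> k > 0 \<Longrightarrow> norm (q ^ k) < 1"
  by (simp add: norm_power power_less_one_iff)

text \<open>Odd and even exponents are separated in the finite product
  \<open>qfact q (2 * m)\<close>; then \<open>m\<close> tends to infinity.\<close>

lemma euler_prod_split:
  assumes "norm q < 1"
  shows "euler_prod q = odd_euler_prod q * euler_prod (q\<^sup>2)"
proof -
  have q2: "norm (q\<^sup>2) < 1" using assms by (intro norm_power_less_one) auto
  have "qfact q (2 * m) = (\<Prod>k<m. 1 - q ^ (2 * k + 1)) * qfact (q\<^sup>2) m" for m
    by (induction m) (simp_all add: qfact_Suc power_mult power_mult_distrib power2_eq_square mult_ac)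
  moreover have "(\<lambda>m. (\<Prod>k<m. 1 - q ^ (2 * k + 1)) * qfact (q\<^sup>2) m)
      \<longlonglongrightarrow> odd_euler_prod q * euler_prod (q\<^sup>2)"
    by (intro tendsto_mult qfact_tendsto q2 has_prod_imp_tendsto' odd_euler_prod_has_prod assms)
  moreover have "(\<lambda>m. qfact q (2 * m)) \<longlonglongrightarrow> euler_prod q"
    using LIMSEQ_subseq_LIMSEQ[OF qfact_tendsto[OF assms], of "\<lambda>m. 2 * m"]
    by (simp add: o_def strict_mono_def)
  ultimately show ?thesis by (simp add: LIMSEQ_unique)
qed

lemma odd_euler_prod_neg:
  assumes "norm q < 1"
  shows "odd_euler_prod q * odd_euler_prod (- q) = odd_euler_prod (q\<^sup>2)"
proof -
  have "(\<lambda>k. (1 - q ^ (2 * k + 1)) * (1 - (- q) ^ (2 * k + 1)))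
          has_prod (odd_euler_prod q * odd_euler_prod (- q))"
    using assms by (intro has_prod_mult odd_euler_prod_has_prod) auto
  moreover have "(1 - q ^ (2 * k + 1)) * (1 - (- q) ^ (2 * k + 1)) = 1 - (q\<^sup>2) ^ (2 * k + 1)" for k
    by (simp add: algebra_simps power2_eq_square power_mult_distrib)
  ultimately have "(\<lambda>k. 1 - (q\<^sup>2) ^ (2 * k + 1)) has_prod (odd_euler_prod q * odd_euler_prod (- q))"
    by simp
  moreover have "norm (q\<^sup>2) < 1" using assms by (intro norm_power_less_one) auto
  ultimately show ?thesis using odd_euler_prod_has_prod has_prod_unique2 by blast
qed

text \<open>In the triple product the exponents of the two factors differ by one. Pulling out
  \<open>1 - 1 / z\<close> aligns them, so that the factors combine when \<open>z\<close> is a root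
  of unity of small order.\<close>

lemma jacobi_product:
  assumes "norm p < 1" "p \<noteq> 0" "z \<noteq> 0"
    and "(\<lambda>k. (1 - z * p ^ Suc k) * (1 - p ^ Suc k / z)) has_prod X"
  shows "(\<Sum>\<^sub>\<infinity>n. jacobi_coeff z p n) = (1 - 1 / z) * X * euler_prod p"
proof -
  let ?F = "\<lambda>m. \<Prod>k<m. (1 - z * p ^ Suc k) * (1 - p ^ k / z)"
  let ?G = "\<lambda>m. \<Prod>k<m. (1 - z * p ^ Suc k) * (1 - p ^ Suc k / z)"
  have "?F m * (1 - p ^ m / z) = (1 - 1 / z) * ?G m" for m
  proof (induction m)
    case (Suc m)
    have "?F (Suc m) * (1 - p ^ Suc m / z)
        = (?F m * (1 - p ^ m / z)) * ((1 - z * p ^ Suc m) * (1 - p ^ Suc m / z))"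
      by (simp only: prod.lessThan_Suc mult_ac)
    thus ?case unfolding Suc by (simp only: prod.lessThan_Suc mult_ac)
  qed simp
  moreover have "(\<lambda>m. ?F m * (1 - p ^ m / z))
      \<longlonglongrightarrow> (\<Sum>\<^sub>\<infinity>n. jacobi_coeff z p n) / euler_prod p * (1 - 0 / z)"
    using assms by (intro tendsto_intros jacobi_triple_product LIMSEQ_power_zero)
  moreover have "(\<lambda>m. (1 - 1 / z) * ?G m) \<longlonglongrightarrow> (1 - 1 / z) * X"
    by (intro tendsto_intros has_prod_imp_tendsto' assms)
  ultimately have "(\<Sum>\<^sub>\<infinity>n. jacobi_coeff z p n) / euler_prod p * (1 - 0 / z) = (1 - 1 / z) * X"
    by (simp add: LIMSEQ_unique)
  thus ?thesis using euler_prod_nonzero[OF assms(1)] by (simp add: divide_eq_eq)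
qed

definition theta :: "complex \<Rightarrow> complex \<Rightarrow> complex" where
  "theta z q = (\<Sum>\<^sub>\<infinity>n. z powi n * q ^ nat (n\<^sup>2))"

text \<open>In Ramanujan's notation, \<open>phi\<close> is \<open>\<phi>\<close> and \<open>psi2\<close> is \<open>2\<psi>\<close>.\<close>

definition phi :: "complex \<Rightarrow> complex" where
  "phi q = (\<Sum>\<^sub>\<infinity>n :: int. q ^ nat (n\<^sup>2))"

definition psi2 :: "complex \<Rightarrow> complex" where
  "psi2 q = (\<Sum>\<^sub>\<infinity>n. q ^ tri n)"

lemma phi_eq_theta: "phi q = theta 1 q"
  by (simp add: phi_def theta_def)

lemma power_square_neg: "(- q) ^ nat (n\<^sup>2) = (- 1) powi n * (q :: complex) ^ nat (n\<^sup>2)"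
proof -
  have "even (nat (n\<^sup>2)) \<longleftrightarrow> even n" by (simp add: even_nat_iff)
  thus ?thesis by (auto simp: power_int_minus_left power_minus_odd)
qed

lemma theta_neg: "theta z (- q) = theta (- z) q"
proof -
  have "(- z) powi n = z powi n * (- 1) powi n" for n
    by (simp add: power_int_minus_left)
  thus ?thesis unfolding theta_def power_square_neg by (simp add: mult_ac)
qed

text \<open>Since 2 tri(n) = n^2 + n, base q^2 produces q^(n^2) and a surplus factor
  \<open>q powi n\<close>, which the division of \<open>w\<close> by \<open>q\<close> cancels. This
  is how the triple product applies to \<open>theta\<close>.\<close>

lemma jacobi_coeff_square:
  assumes "q \<noteq> 0"
  shows "jacobi_coeff (w / q) (q\<^sup>2) n = (- w) powi n * q ^ nat (n\<^sup>2)"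
proof -
  have "(q\<^sup>2) ^ tri n = q powi (2 * int (tri n))"
    by (metis power_int_of_nat power_mult of_nat_mult of_nat_numeral)
  also have "\<dots> = q powi (n\<^sup>2) * q powi n"
    unfolding two_tri using assms by (simp add: power2_eq_square algebra_simps power_int_add)
  finally have "(q\<^sup>2) ^ tri n = q powi (n\<^sup>2) * q powi n" .
  moreover have "(- (w / q)) powi n = (- w) powi n / q powi n"
    using power_int_divide_distrib[of "- w" q n] by simp
  ultimately show ?thesis
    using assms unfolding jacobi_coeff_def by (simp add: power_int_nonneg_exp)
qed

lemma summable_theta:
  fixes q z :: complex
  assumes "norm q < 1" "q \<noteq> 0" "z \<noteq> 0"
  shows "(\<lambda>n. norm (of_int n * (z powi n * q ^ nat (n\<^sup>2)))) summable_on UNIV"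
    and "(\<lambda>n. norm (z powi n * q ^ nat (n\<^sup>2))) summable_on UNIV"
proof -
  have "jacobi_coeff (- z / q) (q\<^sup>2) n = z powi n * q ^ nat (n\<^sup>2)" for n
    using jacobi_coeff_square[OF assms(2), of "- z" n] by (simp only: minus_minus)
  note eq = this
  have "norm (q\<^sup>2) < 1" "- z / q \<noteq> 0" using assms by (auto intro: norm_power_less_one)
  from summable_jacobi[OF this]
  show "(\<lambda>n. norm (of_int n * (z powi n * q ^ nat (n\<^sup>2)))) summable_on UNIV"
    and "(\<lambda>n. norm (z powi n * q ^ nat (n\<^sup>2))) summable_on UNIV"
    unfolding eq by this
qed

text \<open>The triple product in base q^2 at \<open>w / q\<close>. The argument of
  \<open>theta\<close> is \<open>- w\<close> because \<open>jacobi_coeff\<close> carries powers of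
  \<open>- z\<close>.\<close>

lemma theta_product:
  assumes "norm q < 1" "q \<noteq> 0" "w \<noteq> 0"
    and "(\<lambda>k. (1 - w * q ^ (2 * k + 1)) * (1 - q ^ (2 * k + 1) / w)) has_prod X"
  shows "theta (- w) q = X * euler_prod (q\<^sup>2)"
proof -
  have q2: "norm (q\<^sup>2) < 1" using assms by (intro norm_power_less_one) auto
  have "(\<lambda>m. \<Prod>k<m. (1 - w / q * (q\<^sup>2) ^ Suc k) * (1 - (q\<^sup>2) ^ k / (w / q)))
          \<longlonglongrightarrow> (\<Sum>\<^sub>\<infinity>n. jacobi_coeff (w / q) (q\<^sup>2) n) / euler_prod (q\<^sup>2)"
    using assms by (intro jacobi_triple_product q2) auto
  moreover have "(1 - w / q * (q\<^sup>2) ^ Suc k) * (1 - (q\<^sup>2) ^ k / (w / q))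
      = (1 - w * q ^ (2 * k + 1)) * (1 - q ^ (2 * k + 1) / w)" for k
    using assms by (simp add: power_mult power2_eq_square mult_ac flip: power_mult_distrib)
  ultimately have "(\<Sum>\<^sub>\<infinity>n. jacobi_coeff (w / q) (q\<^sup>2) n) / euler_prod (q\<^sup>2) = X"
    using has_prod_imp_tendsto'[OF assms(4)] by (simp add: LIMSEQ_unique)
  thus ?thesis
    using euler_prod_nonzero[OF q2] assms(2) unfolding theta_def jacobi_coeff_square[OF assms(2)]
    by (simp add: divide_eq_eq)
qed

text \<open>The triple product at z = -1: the factors are squares of 1 + p^k = (1 - p^(2k)) / (1 -
  p^k), and the leading factor \<open>1 - 1 / z\<close> is 2.\<close>

lemma psi2_product:
  assumes "norm p < 1" "p \<noteq> 0"
  shows "psi2 p = 2 * euler_prod (p\<^sup>2) ^ 2 / euler_prod p"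
proof -
  have p2: "norm (p\<^sup>2) < 1" using assms by (intro norm_power_less_one) auto
  have "(\<lambda>k. ((1 - (p\<^sup>2) ^ Suc k) / (1 - p ^ Suc k)) ^ 2) has_prod (euler_prod (p\<^sup>2) / euler_prod p) ^ 2"
    by (intro has_prod_power has_prod_divide euler_prod_has_prod assms p2)
  moreover have "((1 - (p\<^sup>2) ^ Suc k) / (1 - p ^ Suc k)) ^ 2 = (1 - (- 1) * p ^ Suc k) * (1 - p ^ Suc k / (- 1))" for k
  proof -
    have "1 - (p\<^sup>2) ^ Suc k = (1 - p ^ Suc k) * (1 + p ^ Suc k)"
      by (simp add: algebra_simps power2_eq_square power_mult_distrib)
    moreover have "1 - p ^ Suc k \<noteq> 0" by (intro one_minus_power_nonzero assms) auto
    ultimately have "(1 - (p\<^sup>2) ^ Suc k) / (1 - p ^ Suc k) = 1 + p ^ Suc k" by simp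
    thus ?thesis by (simp add: power2_eq_square)
  qed
  ultimately have "(\<Sum>\<^sub>\<infinity>n. jacobi_coeff (- 1) p n)
      = (1 - 1 / (- 1)) * (euler_prod (p\<^sup>2) / euler_prod p) ^ 2 * euler_prod p"
    using assms by (intro jacobi_product) simp_all
  thus ?thesis using euler_prod_nonzero[OF assms(1)]
    by (simp add: psi2_def jacobi_coeff_def power_divide power2_eq_square)
qed

lemma phi_neg_product:
  assumes "norm q < 1" "q \<noteq> 0"
  shows "phi (- q) = odd_euler_prod q ^ 2 * euler_prod (q\<^sup>2)"
proof -
  have "(\<lambda>k. (1 - q ^ (2 * k + 1)) ^ 2) has_prod odd_euler_prod q ^ 2"
    by (intro has_prod_power odd_euler_prod_has_prod assms)
  thus ?thesis unfolding phi_eq_theta theta_neg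
    using assms by (intro theta_product) (auto simp: power2_eq_square)
qed

text \<open>By 1 + w + w^2 = 0 the left side is 1 + x + x^2. Thus triple products at cube roots of
  unity become quotients of Euler products.\<close>

lemma cube_root_unity_factor:
  fixes w x :: complex
  assumes "w ^ 3 = 1" "w \<noteq> 1" "x \<noteq> 1"
  shows "(1 - w * x) * (1 - x / w) = (1 - x ^ 3) / (1 - x)"
proof -
  have w0: "w \<noteq> 0" using assms by auto
  have "(w - 1) * (w ^ 2 + w + 1) = 0" using assms by (simp add: algebra_simps power2_eq_square power3_eq_cube)
  hence "w ^ 2 + w + 1 = 0" using assms by simp
  hence w: "w ^ 2 = - w - 1" by (simp add: eq_diff_eq eq_neg_iff_add_eq_0 add_ac)
  have iw: "1 / w = w ^ 2"
    using w0 assms by (simp add: field_simps power2_eq_square power3_eq_cube)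
  have "(1 - w * x) * (1 - x * w ^ 2) = 1 + x + x ^ 2"
  proof -
    have "(1 - w * x) * (1 - x * w ^ 2) = 1 - x * (w + w ^ 2) + w ^ 3 * x ^ 2"
      by (simp add: algebra_simps power2_eq_square power3_eq_cube)
    thus ?thesis by (simp add: w assms)
  qed
  moreover have "x / w = x * w ^ 2" unfolding iw[symmetric] by simp
  moreover have "(1 + x + x ^ 2) * (1 - x) = 1 - x ^ 3"
    by (simp add: algebra_simps power2_eq_square power3_eq_cube)
  ultimately show ?thesis using assms by (simp add: eq_divide_eq)
qed

lemma jacobi_cube_root_unity:
  fixes w :: complex
  assumes "norm p < 1" "p \<noteq> 0" "w ^ 3 = 1" "w \<noteq> 1"
  shows "(\<Sum>\<^sub>\<infinity>n. jacobi_coeff w p n) = (1 - 1 / w) * euler_prod (p ^ 3)"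
proof -
  have p3: "norm (p ^ 3) < 1" using assms by (intro norm_power_less_one) auto
  have "(\<lambda>k. (1 - (p ^ 3) ^ Suc k) / (1 - p ^ Suc k)) has_prod (euler_prod (p ^ 3) / euler_prod p)"
    by (intro has_prod_divide euler_prod_has_prod assms p3)
  moreover have "(1 - (p ^ 3) ^ Suc k) / (1 - p ^ Suc k) = (1 - w * p ^ Suc k) * (1 - p ^ Suc k / w)" for k
  proof -
    have "1 - p ^ Suc k \<noteq> 0" by (intro one_minus_power_nonzero assms) auto
    hence "p ^ Suc k \<noteq> 1" by auto
    from cube_root_unity_factor[OF assms(3,4) this]
    show ?thesis by (simp only: power_mult[symmetric] mult.commute)
  qed
  ultimately have "(\<Sum>\<^sub>\<infinity>n. jacobi_coeff w p n)
      = (1 - 1 / w) * (euler_prod (p ^ 3) / euler_prod p) * euler_prod p"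
    using assms by (intro jacobi_product) (simp_all, auto)
  thus ?thesis using euler_prod_nonzero[OF assms(1)] by simp
qed

lemma theta_cube_root_unity:
  fixes w :: complex
  assumes "norm q < 1" "q \<noteq> 0" "w ^ 3 = 1" "w \<noteq> 1"
  shows "theta (- w) q = odd_euler_prod (q ^ 3) / odd_euler_prod q * euler_prod (q\<^sup>2)"
proof (rule theta_product)
  have q3: "norm (q ^ 3) < 1" using assms by (intro norm_power_less_one) auto
  have "(\<lambda>k. (1 - (q ^ 3) ^ (2 * k + 1)) / (1 - q ^ (2 * k + 1)))
          has_prod (odd_euler_prod (q ^ 3) / odd_euler_prod q)"
    by (intro has_prod_divide odd_euler_prod_has_prod assms q3)
  moreover have "(1 - (q ^ 3) ^ (2 * k + 1)) / (1 - q ^ (2 * k + 1))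
      = (1 - w * q ^ (2 * k + 1)) * (1 - q ^ (2 * k + 1) / w)" for k
  proof -
    have "1 - q ^ (2 * k + 1) \<noteq> 0" by (intro one_minus_power_nonzero assms) auto
    hence "q ^ (2 * k + 1) \<noteq> 1" by auto
    from cube_root_unity_factor[OF assms(3,4) this]
    show ?thesis by (simp only: power_mult[symmetric] mult.commute)
  qed
  ultimately show "(\<lambda>k. (1 - w * q ^ (2 * k + 1)) * (1 - q ^ (2 * k + 1) / w))
          has_prod (odd_euler_prod (q ^ 3) / odd_euler_prod q)" by simp
qed (use assms in auto)

lemma eta_product:
  assumes "norm q < 1"
  shows "(\<Prod>k. eta_factor (Suc k) q)
       = euler_prod (q ^ 2) * euler_prod (q ^ 4) * euler_prod (q ^ 6) * euler_prod (q ^ 12)"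
proof -
  have "(\<lambda>k. (1 - (q ^ 2) ^ Suc k) * (1 - (q ^ 4) ^ Suc k) * (1 - (q ^ 6) ^ Suc k) * (1 - (q ^ 12) ^ Suc k))
     has_prod (euler_prod (q ^ 2) * euler_prod (q ^ 4) * euler_prod (q ^ 6) * euler_prod (q ^ 12))"
    using assms by (intro has_prod_mult euler_prod_has_prod norm_power_less_one) auto
  hence "(\<lambda>k. eta_factor (Suc k) q) has_prod
     (euler_prod (q ^ 2) * euler_prod (q ^ 4) * euler_prod (q ^ 6) * euler_prod (q ^ 12))"
    by (simp only: eta_factor_def power_mult)
  thus ?thesis by (rule has_prod_unique[symmetric])
qed

section \<open>The logarithmic derivative of theta\<close>

lemma abs_summable_times:
  fixes f :: "'a \<Rightarrow> complex" and g :: "'b \<Rightarrow> complex"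
  assumes "(\<lambda>x. norm (f x)) summable_on A" "(\<lambda>y. norm (g y)) summable_on B"
  shows "(\<lambda>(x, y). norm (f x * g y)) summable_on A \<times> B"
    and "((\<lambda>(x, y). f x * g y) has_sum (infsum f A * infsum g B)) (A \<times> B)"
proof -
  show S: "(\<lambda>(x, y). norm (f x * g y)) summable_on A \<times> B"
  proof (rule summable_on_SigmaI)
    show "((\<lambda>y. case (x, y) of (x, y) \<Rightarrow> norm (f x * g y)) has_sum
             (norm (f x) * infsum (\<lambda>y. norm (g y)) B)) B" for x
      unfolding prod.case norm_mult by (intro has_sum_cmult_right has_sum_infsum assms)
    show "(\<lambda>x. norm (f x) * infsum (\<lambda>y. norm (g y)) B) summable_on A"
      by (intro summable_on_cmult_left assms)
  qed auto
  have "(\<lambda>(x, y). f x * g y) summable_on A \<times> B"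
    by (rule abs_summable_summable) (use S in \<open>simp add: case_prod_unfold\<close>)
  thus "((\<lambda>(x, y). f x * g y) has_sum (infsum f A * infsum g B)) (A \<times> B)"
    using has_sum_cmult_right[OF has_sum_infsum[OF abs_summable_summable[OF assms(2)]]]
      has_sum_cmult_left[OF has_sum_infsum[OF abs_summable_summable[OF assms(1)]]]
    by (intro has_sum_SigmaI[where g = "\<lambda>x. f x * infsum g B"]) auto
qed

lemma has_sum_int_split:
  fixes f :: "int \<Rightarrow> complex"
  assumes "(f has_sum S) UNIV"
  shows "((\<lambda>d. f (int (Suc d)) + f (- int (Suc d))) has_sum (S - f 0)) UNIV"
proof -
  have summ: "f summable_on A" for A
    using summable_on_subset_banach[OF has_sum_imp_summable[OF assms]] by blast
  define a b where "a = infsum f {1..}" and "b = infsum f {..-1}"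
  have a: "(f has_sum a) {1..}" and b: "(f has_sum b) {..-1}"
    unfolding a_def b_def by (intro has_sum_infsum summ)+
  have "(f has_sum (f 0 + (a + b))) (insert 0 ({1..} \<union> {..-1}))"
    by (intro has_sum_insert has_sum_Un_disjoint a b) auto
  moreover have "insert 0 ({1..} \<union> {..-1}) = (UNIV :: int set)" by auto
  ultimately have "S = f 0 + (a + b)" using assms has_sum_unique by metis
  moreover have "((\<lambda>d. f (int (Suc d))) has_sum a) UNIV"
    using a by (subst has_sum_reindex_bij_witness[of _ "\<lambda>n. nat (n - 1)" "\<lambda>d. int (Suc d)" "{1..}" f]) auto
  moreover have "((\<lambda>d. f (- int (Suc d))) has_sum b) UNIV"
    using b by (subst has_sum_reindex_bij_witness[of _ "\<lambda>n. nat (- n - 1)" "\<lambda>d. - int (Suc d)" "{..-1}" f]) auto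
  ultimately show ?thesis using has_sum_add by fastforce
qed

text \<open>The reflection of \<open>d\<close> to \<open>- (2 * n + 1) - d\<close> fixes the
  exponent and flips the sign, because \<open>2 * n + 1\<close> is odd. So the sum equals its own
  negative.\<close>

lemma alternating_square_sum:
  fixes q :: complex
  assumes "norm q < 1" "q \<noteq> 0"
  shows "((\<lambda>d. (- 1) powi d * q powi (d\<^sup>2 + (2 * n + 1) * d)) has_sum 0) UNIV"
proof -
  define t where "t = (\<lambda>d. (- 1) powi d * q powi (d\<^sup>2 + (2 * n + 1) * d))"
  \<comment> \<open>The comparison with \<open>jacobi_coeff\<close> serves to obtain
    summability.\<close>
  have "t d = jacobi_coeff (q powi (2 * n)) (q\<^sup>2) d" for d
  proof -
    have "(q\<^sup>2) ^ tri d = q powi (2 * int (tri d))"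
      by (metis power_int_of_nat power_mult of_nat_mult of_nat_numeral)
    moreover have "(- (q powi (2 * n))) powi d = (- 1) powi d * q powi (2 * n * d)"
      by (simp add: power_int_minus_left power_int_mult)
    moreover have "d\<^sup>2 + (2 * n + 1) * d = 2 * n * d + 2 * int (tri d)"
      using two_tri[of d] by (simp add: power2_eq_square algebra_simps)
    ultimately show ?thesis
      using assms unfolding t_def jacobi_coeff_def by (simp add: power_int_add)
  qed
  hence "t = jacobi_coeff (q powi (2 * n)) (q\<^sup>2)" by auto
  moreover have "(\<lambda>d. norm (jacobi_coeff (q powi (2 * n)) (q\<^sup>2) d)) summable_on UNIV"
    using assms by (intro summable_jacobi norm_power_less_one) auto
  ultimately have "t summable_on UNIV" by (simp add: abs_summable_summable)
  then obtain S where S: "(t has_sum S) UNIV" by (auto simp: summable_on_def)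
  have "t (- (2 * n + 1) - d) = - t d" for d
  proof -
    have "(- (2 * n + 1) - d)\<^sup>2 + (2 * n + 1) * (- (2 * n + 1) - d) = d\<^sup>2 + (2 * n + 1) * d"
      by (simp add: power2_eq_square algebra_simps)
    thus ?thesis by (simp add: t_def power_int_minus_left)
  qed
  hence "(t has_sum S) UNIV \<longleftrightarrow> ((\<lambda>d. - t d) has_sum S) UNIV"
    by (intro has_sum_reindex_bij_witness[of _ "\<lambda>d. - (2 * n + 1) - d" "\<lambda>d. - (2 * n + 1) - d"]) auto
  hence "S = - S" using S has_sum_uminusI[OF S] has_sum_unique by blast
  thus ?thesis using S by (simp add: t_def)
qed

section \<open>The Lambert series and its product with theta\<close>

definition lambert_coeff :: "complex \<Rightarrow> nat \<Rightarrow> complex" where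
  "lambert_coeff q d = (- 1) ^ d * q ^ Suc d / (1 - q ^ (2 * Suc d))"

text \<open>With k = \<open>Suc d\<close> this is the sum over k >= 1 of (-1)^(k-1) q^k (z^k -
  z^(-k)) / (1 - q^(2k)). Formally it comes from applying z d/dz log to the triple product for
  \<open>theta z q\<close> and expanding every factor geometrically.\<close>

definition lambert :: "complex \<Rightarrow> complex \<Rightarrow> complex" where
  "lambert z q = (\<Sum>\<^sub>\<infinity>d. lambert_coeff q d * (z powi int (Suc d) - z powi (- int (Suc d))))"

lemma summable_lambert_coeff:
  assumes "norm q < 1"
  shows "(\<lambda>d. norm (lambert_coeff q d)) summable_on UNIV"
proof (rule Infinite_Sum.abs_summable_on_comparison_test')
  have "summable (\<lambda>d. norm q ^ d)" using assms by (intro summable_geometric) auto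
  hence "(\<lambda>d. norm q ^ d) summable_on UNIV" by (subst summable_on_UNIV_nonneg_real_iff) auto
  thus "(\<lambda>d. norm q ^ d * (1 / (1 - norm q))) summable_on UNIV" by (rule summable_on_cmult_left)
  fix d
  have "norm q ^ (2 * Suc d) \<le> norm q ^ 1" using assms by (intro power_decreasing) auto
  hence "1 - norm q \<le> norm (1 - q ^ (2 * Suc d))"
    using norm_triangle_ineq2[of 1 "q ^ (2 * Suc d)"] by (simp add: norm_power del: mult_Suc_right)
  moreover have "norm q ^ Suc d \<le> norm q ^ d" using assms by (intro power_decreasing) auto
  ultimately have "norm q ^ Suc d / norm (1 - q ^ (2 * Suc d)) \<le> norm q ^ d / (1 - norm q)"
    using assms by (intro frac_le) auto
  thus "norm (lambert_coeff q d) \<le> norm q ^ d * (1 / (1 - norm q))"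
    by (simp add: lambert_coeff_def norm_divide norm_mult norm_power del: power_Suc mult_Suc_right)
qed

text \<open>Up to the factor q^(n^2), the left side is the coefficient of z^n in
  \<open>theta z q * lambert z q\<close>. Passing from n to n + 1 cancels the denominators and
  leaves minus the series of \<open>alternating_square_sum\<close> without its term at 0, that is 1.
  The induction runs in both directions from n = 0.\<close>

lemma lambert_telescope:
  fixes q :: complex
  assumes "norm q < 1" "q \<noteq> 0"
  shows "((\<lambda>d. lambert_coeff q d * q ^ (Suc d)\<^sup>2 *
            (q powi (- 2 * n * int (Suc d)) - q powi (2 * n * int (Suc d)))) has_sum of_int n) UNIV"
proof -
  note pia = power_int_add[OF disjI1[OF assms(2)]]
  define f where "f = (\<lambda>n d. lambert_coeff q d * q ^ (Suc d)\<^sup>2 *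
      (q powi (- 2 * n * int (Suc d)) - q powi (2 * n * int (Suc d))))"
  have step: "((\<lambda>d. f (n + 1) d - f n d) has_sum 1) UNIV" for n
  proof -
    let ?t = "\<lambda>d. (- 1) powi d * q powi (d\<^sup>2 + (2 * n + 1) * d)"
    have "((\<lambda>d. - (?t (int (Suc d)) + ?t (- int (Suc d)))) has_sum - (0 - ?t 0)) UNIV"
      by (intro has_sum_uminusI has_sum_int_split alternating_square_sum assms)
    moreover have "- (?t (int (Suc d)) + ?t (- int (Suc d))) = f (n + 1) d - f n d" for d
    proof -
      define x y s where "x = q ^ Suc d" and "y = q powi (n * int (Suc d))" and "s = q ^ (Suc d)\<^sup>2"
      have nz: "x \<noteq> 0" "y \<noteq> 0" "s \<noteq> 0" "1 - x\<^sup>2 \<noteq> 0"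
        using assms one_minus_power_nonzero[of q "2 * Suc d"]
        by (auto simp: x_def y_def s_def simp flip: power_mult simp del: power_Suc mult_Suc_right)
          (auto simp: mult.commute)
      have y2: "q powi (2 * n * int (Suc d)) = y\<^sup>2"
        unfolding y_def power_int_power' by (simp add: mult_ac)
      have x: "q powi int (Suc d) = x" by (simp only: x_def power_int_of_nat)
      have s: "q powi (int (Suc d))\<^sup>2 = s"
        unfolding s_def by (simp only: of_nat_power[symmetric] power_int_of_nat)
      have y2': "q powi (2 * (n + 1) * int (Suc d)) = y\<^sup>2 * x\<^sup>2"
      proof -
        have "2 * (n + 1) * int (Suc d) = 2 * n * int (Suc d) + int (Suc d) * 2"
          by (simp add: algebra_simps)
        moreover have "q powi (int (Suc d) * 2) = x\<^sup>2"
          using power_int_power'[of q "int (Suc d)" 2] x by (simp del: of_nat_Suc)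
        ultimately show ?thesis by (simp only: pia y2)
      qed
      have lc: "lambert_coeff q d = (- 1) ^ d * (x / (1 - x\<^sup>2))"
        by (simp only: lambert_coeff_def x_def power_mult[symmetric] mult.commute times_divide_eq_right)
      have f: "f n d = (- 1) ^ d * (x / (1 - x\<^sup>2)) * s * (inverse (y\<^sup>2) - y\<^sup>2)"
        unfolding f_def lc s_def[symmetric] using y2
        by (simp only: mult_minus_left power_int_minus)
      have f': "f (n + 1) d = (- 1) ^ d * (x / (1 - x\<^sup>2)) * s * (inverse (y\<^sup>2 * x\<^sup>2) - y\<^sup>2 * x\<^sup>2)"
        unfolding f_def lc s_def[symmetric] using y2'
        by (simp only: mult_minus_left power_int_minus)
      have m1: "(- 1) powi int (Suc d) = - ((- 1) ^ d :: complex)"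
        by (simp only: power_int_of_nat power_Suc) simp
      have m2: "(- 1) powi (- int (Suc d)) = - ((- 1) ^ d :: complex)"
        by (simp only: power_int_minus m1) (simp add: power_inverse[symmetric])
      have "(int (Suc d))\<^sup>2 + (2 * n + 1) * int (Suc d)
          = (int (Suc d))\<^sup>2 + (2 * n * int (Suc d) + int (Suc d))" by (simp add: algebra_simps)
      hence t1: "?t (int (Suc d)) = - ((- 1) ^ d * (s * (y\<^sup>2 * x)))"
        by (simp only: pia y2 x s m1 mult_minus_left)
      have "(- int (Suc d))\<^sup>2 + (2 * n + 1) * (- int (Suc d))
          = (int (Suc d))\<^sup>2 + - (2 * n * int (Suc d) + int (Suc d))"
        by (simp add: algebra_simps power2_eq_square)
      hence t2: "?t (- int (Suc d)) = - ((- 1) ^ d * (s * inverse (y\<^sup>2 * x)))"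
        by (simp only: m2) (simp only: pia power_int_minus y2 x s inverse_mult_distrib mult_minus_left)
      have "x / (1 - x\<^sup>2) * (inverse (y\<^sup>2 * x\<^sup>2) - y\<^sup>2 * x\<^sup>2 - (inverse (y\<^sup>2) - y\<^sup>2))
          = y\<^sup>2 * x + inverse (y\<^sup>2 * x)"
      proof -
        have "b - a * X - (X * b - a) = (1 - X) * (b + a)" for a b X :: complex
          by (simp add: algebra_simps)
        moreover have "inverse (y\<^sup>2) = x\<^sup>2 * inverse (y\<^sup>2 * x\<^sup>2)" using nz by simp
        ultimately have "inverse (y\<^sup>2 * x\<^sup>2) - y\<^sup>2 * x\<^sup>2 - (inverse (y\<^sup>2) - y\<^sup>2)
            = (1 - x\<^sup>2) * (inverse (y\<^sup>2 * x\<^sup>2) + y\<^sup>2)"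
          by metis
        thus ?thesis using nz by (simp add: distrib_left power2_eq_square)
      qed
      hence "(- 1) ^ d * s * (x / (1 - x\<^sup>2) * (inverse (y\<^sup>2 * x\<^sup>2) - y\<^sup>2 * x\<^sup>2 - (inverse (y\<^sup>2) - y\<^sup>2)))
          = (- 1) ^ d * s * (y\<^sup>2 * x + inverse (y\<^sup>2 * x))"
        by (simp only:)
      moreover have "e * s * (c * (A' - A)) = e * s * (Y + Z) \<Longrightarrow>
          - (- (e * (s * Y)) + - (e * (s * Z))) = e * c * s * A' - e * c * s * A" for e c A A' Y Z
        by (simp add: algebra_simps)
      ultimately show ?thesis unfolding t1 t2 f f' by blast
    qed
    ultimately show ?thesis by simp
  qed
  have "(f n has_sum of_int n) UNIV"
  proof (induction n rule: int_induct[where k = 0])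
    case base
    show ?case by (simp add: f_def)
  next
    case (step1 i)
    from has_sum_add[OF step1(2) step[of i]] show ?case by simp
  next
    case (step2 i)
    from has_sum_diff[OF step2(2) step[of "i - 1"]] show ?case by simp
  qed
  thus ?thesis by (simp add: f_def)
qed

text \<open>No product is differentiated: \<open>theta z q * lambert z q\<close> is written as a
  double series, reindexed by the total power of \<open>z\<close>, and its inner sum is
  \<open>lambert_telescope\<close>. On the unit circle powers of \<open>z\<close> have norm 1, which
  gives absolute convergence.\<close>

lemma theta_log_derivative:
  fixes q z :: complex
  assumes "norm q < 1" "q \<noteq> 0" "norm z = 1"
  shows "(\<Sum>\<^sub>\<infinity>n. of_int n * (z powi n * q ^ nat (n\<^sup>2))) = theta z q * lambert z q"
proof -
  have z0: "z \<noteq> 0" using assms by auto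
  let ?th = "\<lambda>n. z powi n * q ^ nat (n\<^sup>2)"
  let ?lc = "lambert_coeff q"
  note sth = summable_theta(2)[OF assms(1,2) z0]
  note slc = summable_lambert_coeff[OF assms(1)]
  have slz: "(\<lambda>d. norm (?lc d * z powi (e * int (Suc d)))) summable_on UNIV" for e
    using slc by (simp add: norm_mult norm_power_int assms(3))
  \<comment> \<open>The values 1 and -1 of \<open>e\<close> treat the two powers of \<open>z\<close>
    in each Lambert term; the new index \<open>n\<close> is the total power of
    \<open>z\<close>.\<close>
  have split: "((\<lambda>(n, d). z powi n * ?lc d * q ^ nat ((n - e * int (Suc d))\<^sup>2))
      has_sum (theta z q * (\<Sum>\<^sub>\<infinity>d. ?lc d * z powi (e * int (Suc d))))) (UNIV \<times> UNIV)" for e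
  proof -
    have "((\<lambda>(k, d). ?th k * (?lc d * z powi (e * int (Suc d))))
       has_sum (theta z q * (\<Sum>\<^sub>\<infinity>d. ?lc d * z powi (e * int (Suc d))))) (UNIV \<times> UNIV)"
      unfolding theta_def by (rule abs_summable_times(2)[OF sth slz])
    thus ?thesis
      by (subst has_sum_reindex_bij_witness[of _ "\<lambda>(k, d). (k + e * int (Suc d), d)"
            "\<lambda>(n, d). (n - e * int (Suc d), d)" "UNIV \<times> UNIV"
            "\<lambda>(k, d). ?th k * (?lc d * z powi (e * int (Suc d)))"])
         (use z0 in \<open>auto simp: power_int_diff simp del: of_nat_Suc\<close>)
  qed
  have "lambert z q = (\<Sum>\<^sub>\<infinity>d. ?lc d * z powi (1 * int (Suc d))) - (\<Sum>\<^sub>\<infinity>d. ?lc d * z powi (- 1 * int (Suc d)))"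
  proof -
    have "((\<lambda>d. ?lc d * z powi (1 * int (Suc d)) - ?lc d * z powi (- 1 * int (Suc d)))
       has_sum ((\<Sum>\<^sub>\<infinity>d. ?lc d * z powi (1 * int (Suc d))) - (\<Sum>\<^sub>\<infinity>d. ?lc d * z powi (- 1 * int (Suc d))))) UNIV"
      by (intro has_sum_diff has_sum_infsum abs_summable_summable[OF slz])
    thus ?thesis unfolding lambert_def by (intro infsumI) (simp add: right_diff_distrib)
  qed
  hence "((\<lambda>(n, d). z powi n * ?lc d * q ^ nat ((n - 1 * int (Suc d))\<^sup>2)
         - z powi n * ?lc d * q ^ nat ((n - (- 1) * int (Suc d))\<^sup>2)) has_sum (theta z q * lambert z q)) (UNIV \<times> UNIV)"
    using has_sum_diff[OF split[of 1] split[of "- 1"]] by (simp add: case_prod_unfold right_diff_distrib)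
  moreover have "((\<lambda>d. case (n, d) of (n, d) \<Rightarrow> z powi n * ?lc d * q ^ nat ((n - 1 * int (Suc d))\<^sup>2)
         - z powi n * ?lc d * q ^ nat ((n - (- 1) * int (Suc d))\<^sup>2)) has_sum (of_int n * ?th n)) UNIV" for n
  proof -
    have "((\<lambda>d. ?th n * (?lc d * q ^ (Suc d)\<^sup>2 *
            (q powi (- 2 * n * int (Suc d)) - q powi (2 * n * int (Suc d))))) has_sum (?th n * of_int n)) UNIV"
      by (intro has_sum_cmult_right lambert_telescope assms)
    moreover have "?th n * (?lc d * q ^ (Suc d)\<^sup>2 *
            (q powi (- 2 * n * int (Suc d)) - q powi (2 * n * int (Suc d))))
        = z powi n * ?lc d * q ^ nat ((n - 1 * int (Suc d))\<^sup>2)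
         - z powi n * ?lc d * q ^ nat ((n - (- 1) * int (Suc d))\<^sup>2)" for d
    proof -
      have "q ^ nat ((n + e * int (Suc d))\<^sup>2) = q ^ nat (n\<^sup>2) * q ^ (Suc d)\<^sup>2 * q powi (2 * e * n * int (Suc d))"
        if "e\<^sup>2 = 1" for e
      proof -
        have "(n + e * int (Suc d))\<^sup>2 = n\<^sup>2 + int ((Suc d)\<^sup>2) + 2 * e * n * int (Suc d)"
          using that by (simp add: power2_sum power_mult_distrib mult_ac del: of_nat_Suc)
        moreover have "q ^ nat ((n + e * int (Suc d))\<^sup>2) = q powi ((n + e * int (Suc d))\<^sup>2)"
          by (simp only: power_int_nonneg_exp[symmetric] zero_le_power2)
        moreover have "q ^ nat (n\<^sup>2) = q powi (n\<^sup>2)"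
          by (simp only: power_int_nonneg_exp[symmetric] zero_le_power2)
        ultimately show ?thesis
          by (simp only: power_int_add[OF disjI1[OF assms(2)]] power_int_of_nat)
      qed
      from this[of 1] this[of "- 1"] show ?thesis
        by (simp add: algebra_simps del: of_nat_Suc)
    qed
    ultimately show ?thesis by (simp add: mult.commute)
  qed
  ultimately have "((\<lambda>n. of_int n * ?th n) has_sum (theta z q * lambert z q)) UNIV"
    by (rule has_sum_SigmaD)
  thus ?thesis by (rule infsumI)
qed

section \<open>A Lambert series for \<open>\<psi>(q\<^sup>2) \<psi>(q\<^sup>6)\<close>\<close>

definition chi3 :: "nat \<Rightarrow> int" where
  "chi3 d = (if d mod 3 = 1 then 1 else if d mod 3 = 2 then - 1 else 0)"

lemma cube_root_unity_chi3:
  fixes w :: complex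
  assumes "w ^ 3 = 1"
  shows "w powi int d - w powi (- int d) = of_int (chi3 d) * (w - 1 / w)"
proof -
  have w0: "w \<noteq> 0" using assms by auto
  have w2: "w ^ 2 = inverse w"
    using w0 assms by (simp add: field_simps power2_eq_square power3_eq_cube)
  have "w ^ d = (w ^ 3) ^ (d div 3) * w ^ (d mod 3)"
    by (simp only: power_mult[symmetric] power_add[symmetric] mult_div_mod_eq)
  hence d: "w ^ d = w ^ (d mod 3)" using assms by simp
  have "d mod 3 = 0 \<or> d mod 3 = 1 \<or> d mod 3 = 2" by auto
  thus ?thesis
    by (auto simp: chi3_def power_int_minus d w2 divide_inverse)
qed

definition odd_lambert :: "complex \<Rightarrow> complex" where
  "odd_lambert q = (\<Sum>\<^sub>\<infinity>(d, x)\<in>Collect odd \<times> Collect odd. of_int (chi3 d) * q ^ (d * x))"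

text \<open>For d, x >= 1 one has d x >= d + x - 1, so a product of two geometric series, times
  \<open>1 / norm q\<close>, dominates the terms.\<close>

lemma summable_odd_lambert:
  fixes q :: complex
  assumes "norm q < 1" "q \<noteq> 0"
  shows "(\<lambda>(d, x). norm (of_int (chi3 d) * q ^ (d * x))) summable_on Collect odd \<times> Collect odd"
proof -
  have geo: "(\<lambda>d. norm (q ^ d)) summable_on A" for A
  proof -
    have "summable (\<lambda>d. norm q ^ d)" using assms by (intro summable_geometric) auto
    hence "(\<lambda>d. norm (q ^ d)) summable_on UNIV"
      by (subst summable_on_UNIV_nonneg_real_iff) (auto simp: norm_power)
    thus ?thesis by (rule summable_on_subset_banach) auto
  qed
  have "(\<lambda>(d, x). norm (q ^ d * q ^ x)) summable_on Collect odd \<times> Collect odd"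
    by (intro abs_summable_times geo)
  hence "(\<lambda>y. (case y of (d, x) \<Rightarrow> norm (q ^ d * q ^ x)) * (1 / norm q)) summable_on Collect odd \<times> Collect odd"
    by (rule summable_on_cmult_left)
  thus ?thesis
  proof (rule summable_on_comparison_test)
    fix y :: "nat \<times> nat" assume y: "y \<in> Collect odd \<times> Collect odd"
    obtain d x where dx: "y = (d, x)" by force
    have "d \<ge> 1" "x \<ge> 1" using y dx by (auto simp: Suc_le_eq odd_pos)
    then obtain a b where ab: "d = Suc a" "x = Suc b" by (metis Suc_le_D One_nat_def)
    have "norm (of_int (chi3 d) * q ^ (d * x)) \<le> norm q ^ (d * x)"
      by (simp add: norm_mult norm_power chi3_def)
    also have "\<dots> \<le> norm q ^ (d + b)" using assms ab by (intro power_decreasing) auto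
    also have "\<dots> = norm (q ^ d * q ^ x) * (1 / norm q)"
      using assms ab by (simp add: norm_mult norm_power power_add)
    finally show "(case y of (d, x) \<Rightarrow> norm (of_int (chi3 d) * q ^ (d * x)))
        \<le> (case y of (d, x) \<Rightarrow> norm (q ^ d * q ^ x)) * (1 / norm q)"
      by (simp add: dx)
  qed (auto split: prod.splits)
qed

lemma has_sum_odd_geometric:
  fixes q :: complex
  assumes "norm q < 1" "d > 0"
  shows "((\<lambda>x. q ^ (d * x)) has_sum (q ^ d / (1 - q ^ (2 * d)))) (Collect odd)"
proof -
  have q2: "norm (q ^ (2 * d)) < 1" using assms by (intro norm_power_less_one) auto
  have "((\<lambda>j. (q ^ (2 * d)) ^ j) has_sum (1 / (1 - q ^ (2 * d)))) UNIV"
  proof (rule norm_summable_imp_has_sum)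
    have "summable (\<lambda>j. norm (q ^ (2 * d)) ^ j)" using q2 by (intro summable_geometric) auto
    thus "summable (\<lambda>j. norm ((q ^ (2 * d)) ^ j))" by (simp only: norm_power)
  qed (rule geometric_sums[OF q2])
  hence "((\<lambda>j. q ^ d * (q ^ (2 * d)) ^ j) has_sum (q ^ d * (1 / (1 - q ^ (2 * d))))) UNIV"
    by (rule has_sum_cmult_right)
  also have "?this \<longleftrightarrow> ((\<lambda>x. q ^ (d * x)) has_sum (q ^ d / (1 - q ^ (2 * d)))) (Collect odd)"
    by (rule has_sum_reindex_bij_witness[of _ "\<lambda>x. x div 2" "\<lambda>j. 2 * j + 1"])
       (auto simp: power_add power_mult[symmetric] algebra_simps)
  finally show ?thesis .
qed

lemma has_sum_odd_lambert:
  assumes "norm q < 1" "q \<noteq> 0"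
  shows "((\<lambda>(d, x). of_int (chi3 d) * q ^ (d * x)) has_sum odd_lambert q) (Collect odd \<times> Collect odd)"
proof -
  have "(\<lambda>(d, x). of_int (chi3 d) * q ^ (d * x)) summable_on Collect odd \<times> Collect odd"
    by (rule abs_summable_summable)
       (use summable_odd_lambert[OF assms] in \<open>simp add: case_prod_unfold\<close>)
  thus ?thesis unfolding odd_lambert_def by (rule has_sum_infsum)
qed

text \<open>Passing from \<open>w\<close> to \<open>- w\<close> preserves the terms of even exponent
  and negates those of odd exponent. The powers of \<open>w\<close> give \<open>chi3\<close>, and
  q^d / (1 - q^(2d)) is a geometric series over odd x.\<close>

lemma lambert_odd_part:
  fixes q w :: complex
  assumes "norm q < 1" "q \<noteq> 0" "w ^ 3 = 1" "norm w = 1"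
  shows "lambert w q - lambert (- w) q = 2 * (w - 1 / w) * odd_lambert q"
proof -
  let ?k = "w - 1 / w"
  let ?lam = "\<lambda>z d. lambert_coeff q d * (z powi int (Suc d) - z powi (- int (Suc d)))"
  have summ: "?lam z summable_on UNIV" if "norm z = 1" for z
  proof (rule abs_summable_summable, rule Infinite_Sum.abs_summable_on_comparison_test')
    show "(\<lambda>d. norm (lambert_coeff q d) * 2) summable_on UNIV"
      by (intro summable_on_cmult_left summable_lambert_coeff assms)
    show "norm (?lam z d) \<le> norm (lambert_coeff q d) * 2" for d
    proof -
      have "norm (z powi int (Suc d) - z powi (- int (Suc d))) \<le> 1 + 1"
        using norm_triangle_ineq4[of "z powi int (Suc d)" "z powi (- int (Suc d))"]
        unfolding norm_power_int that by simp
      thus ?thesis unfolding norm_mult by (intro mult_left_mono) auto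
    qed
  qed
  have "((\<lambda>d. ?lam w d - ?lam (- w) d) has_sum (lambert w q - lambert (- w) q)) UNIV"
    unfolding lambert_def using assms by (intro has_sum_diff has_sum_infsum summ) auto
  \<comment> \<open>The exponent is \<open>Suc d\<close>, so the surviving odd exponents belong to
    even \<open>d\<close>.\<close>
  also have "?this \<longleftrightarrow> ((\<lambda>d. 2 * ?k * (of_int (chi3 (Suc d)) * (q ^ Suc d / (1 - q ^ (2 * Suc d)))))
      has_sum (lambert w q - lambert (- w) q)) (Collect even)"
  proof (rule has_sum_cong_neutral)
    fix d :: nat
    show "?lam w d - ?lam (- w) d = 0" if "d \<in> UNIV - Collect even"
      using that by (simp add: power_int_minus_left del: of_nat_Suc)
    show "?lam w d - ?lam (- w) d = 2 * ?k * (of_int (chi3 (Suc d)) * (q ^ Suc d / (1 - q ^ (2 * Suc d))))"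
      if "d \<in> UNIV \<inter> Collect even"
    proof -
      have "(- w) powi int (Suc d) - (- w) powi (- int (Suc d)) = - (w powi int (Suc d) - w powi (- int (Suc d)))"
        using that by (simp add: power_int_minus_left del: of_nat_Suc)
      hence "?lam w d - ?lam (- w) d = 2 * (lambert_coeff q d * (of_int (chi3 (Suc d)) * ?k))"
        unfolding cube_root_unity_chi3[OF assms(3)] by (simp only:) simp
      moreover have "lambert_coeff q d = q ^ Suc d / (1 - q ^ (2 * Suc d))"
        using that by (simp add: lambert_coeff_def)
      ultimately show ?thesis by (simp only: mult_ac)
    qed
  qed auto
  also have "\<dots> \<longleftrightarrow> ((\<lambda>d. 2 * ?k * (of_int (chi3 d) * (q ^ d / (1 - q ^ (2 * d)))))
      has_sum (lambert w q - lambert (- w) q)) (Collect odd)"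
    by (rule has_sum_reindex_bij_witness[of _ "\<lambda>d. d - 1" Suc]) (auto simp: odd_pos)
  finally have "((\<lambda>d. 2 * ?k * (of_int (chi3 d) * (q ^ d / (1 - q ^ (2 * d)))))
      has_sum (lambert w q - lambert (- w) q)) (Collect odd)" .
  moreover have "((\<lambda>d. of_int (chi3 d) * (q ^ d / (1 - q ^ (2 * d)))) has_sum odd_lambert q) (Collect odd)"
    by (rule has_sum_SigmaD[OF has_sum_odd_lambert[OF assms(1,2)]], unfold prod.case)
       (intro has_sum_cmult_right has_sum_odd_geometric assms, auto simp: odd_pos)
  hence "((\<lambda>d. 2 * ?k * (of_int (chi3 d) * (q ^ d / (1 - q ^ (2 * d)))))
      has_sum (2 * ?k * odd_lambert q)) (Collect odd)"
    by (rule has_sum_cmult_right)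
  ultimately show ?thesis by (rule has_sum_unique)
qed

lemma jacobi_one_zero:
  assumes "norm p < 1" "p \<noteq> 0"
  shows "(\<Sum>\<^sub>\<infinity>n. jacobi_coeff 1 p n) = 0"
proof -
  have "(\<lambda>k. (1 - 1 * p ^ Suc k) * (1 - p ^ Suc k / 1)) has_prod (euler_prod p * euler_prod p)"
    using has_prod_mult[OF euler_prod_has_prod euler_prod_has_prod, OF assms(1) assms(1)] by simp
  from jacobi_product[OF assms one_neq_zero this] show ?thesis by simp
qed

text \<open>The left side is a sum over pairs (a, b) with weight a - b. For a + b even, swapping a
  and b negates the term. For a + b odd, a = u + v + 1 and b = u - v give a^2 + b^2 = 1 + 4 tri(u) +
  4 tri(v) and a - b = 2 v + 1, so the sum factors and the one over v is Jacobi's cube.\<close>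

lemma theta_wronskian:
  fixes q w :: complex
  assumes q: "norm q < 1" "q \<noteq> 0" and w: "w \<noteq> 0"
  shows "(\<Sum>\<^sub>\<infinity>n. of_int n * (w powi n * q ^ nat (n\<^sup>2))) * theta (- w) q
       - theta w q * (\<Sum>\<^sub>\<infinity>n. of_int n * ((- w) powi n * q ^ nat (n\<^sup>2)))
       = q * w * (\<Sum>\<^sub>\<infinity>n. jacobi_coeff (w\<^sup>2) (q ^ 4) n) * (2 * euler_prod (q ^ 4) ^ 3)" (is "?W = _")
proof -
  define T where "T = (\<lambda>(a, b). of_int (a - b) * ((w powi a * q ^ nat (a\<^sup>2)) * ((- w) powi b * q ^ nat (b\<^sup>2))))"
  have w': "- w \<noteq> 0" using w by simp
  note S = summable_theta[OF q w] and S' = summable_theta[OF q w']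
  have "(T has_sum ?W) (UNIV \<times> UNIV)"
    using has_sum_diff[OF abs_summable_times(2)[OF S(1) S'(2)] abs_summable_times(2)[OF S(2) S'(1)]]
    by (simp add: T_def theta_def case_prod_unfold algebra_simps)
  hence T: "(T has_sum ?W) UNIV" by simp
  have summ: "T summable_on A" for A
    using summable_on_subset_banach[OF has_sum_imp_summable[OF T]] by blast
  let ?Ev = "{(a :: int, b :: int). even (a + b)}" and ?Od = "{(a :: int, b :: int). odd (a + b)}"
  have "infsum T ?Ev = infsum (\<lambda>x. - T x) ?Ev"
    by (rule infsum_reindex_bij_witness[of _ prod.swap prod.swap])
       (auto simp: T_def power_int_minus_left algebra_simps)
  hence ev: "infsum T ?Ev = 0" by (simp add: infsum_uminus)
  have "?W = infsum T UNIV" using T by (simp add: infsumI)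
  also have "\<dots> = infsum T (?Ev \<union> ?Od)" by (rule arg_cong[where f = "infsum T"]) auto
  also have "\<dots> = infsum T ?Od"
    using ev by (subst infsum_Un_disjoint) (auto intro: summ)
  also have "\<dots> = (\<Sum>\<^sub>\<infinity>(u, v)\<in>UNIV \<times> UNIV. q * w * (jacobi_coeff (w\<^sup>2) (q ^ 4) u
                      * ((2 * of_int v + 1) * jacobi_coeff 1 (q ^ 4) v)))"
  proof -
    have main: "q * w * (jacobi_coeff (w\<^sup>2) (q ^ 4) u * ((2 * of_int v + 1) * jacobi_coeff 1 (q ^ 4) v))
        = T (u + v + 1, u - v)" for u v
    proof -
      have "int (nat ((u + v + 1)\<^sup>2) + nat ((u - v)\<^sup>2)) = int (1 + 4 * tri u + 4 * tri v)"
      proof -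
        have "(u + v + 1)\<^sup>2 + (u - v)\<^sup>2 = 1 + 4 * int (tri u) + 4 * int (tri v)"
          using two_tri[of u] two_tri[of v] by (simp add: power2_eq_square algebra_simps)
        thus ?thesis by simp
      qed
      hence "nat ((u + v + 1)\<^sup>2) + nat ((u - v)\<^sup>2) = 1 + 4 * tri u + 4 * tri v"
        by (simp only: of_nat_eq_iff)
      hence "q ^ nat ((u + v + 1)\<^sup>2) * q ^ nat ((u - v)\<^sup>2) = q * (q ^ 4) ^ tri u * (q ^ 4) ^ tri v"
        by (simp only: power_add[symmetric] power_mult[symmetric]) (simp add: power_add)
      moreover have "w powi (u + v + 1) * (- w) powi (u - v) = w * (- w\<^sup>2) powi u * (- 1) powi v"
      proof -
        have "w powi (u + v + 1) * w powi (u - v) = w powi (1 + 2 * u)"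
          using w by (simp flip: power_int_add add: algebra_simps)
        also have "\<dots> = w * (w\<^sup>2) powi u" using w by (simp add: power_int_add power_int_mult)
        finally have "w powi (u + v + 1) * w powi (u - v) = w * (w\<^sup>2) powi u" .
        thus ?thesis by (auto simp: power_int_minus_left)
      qed
      moreover have "of_int (u + v + 1 - (u - v)) = (2 * of_int v + 1 :: complex)" by simp
      moreover have "T (u + v + 1, u - v) = of_int (u + v + 1 - (u - v)) *
          ((w powi (u + v + 1) * (- w) powi (u - v)) * (q ^ nat ((u + v + 1)\<^sup>2) * q ^ nat ((u - v)\<^sup>2)))"
        unfolding T_def prod.case by (simp only: mult_ac)
      ultimately show ?thesis unfolding jacobi_coeff_def by (simp only: mult_ac)
    qed
    show ?thesis
    proof (rule infsum_reindex_bij_witness[of "UNIV \<times> UNIV"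
              "\<lambda>(a, b). ((a + b - 1) div 2, (a - b - 1) div 2)" "\<lambda>(u, v). (u + v + 1, u - v)" ?Od T, symmetric],
        goal_cases)
      case (3 x)
      obtain a b where x: "x = (a, b)" by force
      have "odd (a + b)" using 3 by (simp add: x)
      then obtain k where k: "a + b = 2 * k + 1" by (elim oddE)
      hence div: "(a + b - 1) div 2 = k" "(a - b - 1) div 2 = k - b" by presburger+
      show ?case unfolding x prod.case div using k by simp
    next
      case (5 x)
      thus ?case using main by (auto split: prod.splits)
    qed auto
  qed
  also have "\<dots> = q * w * ((\<Sum>\<^sub>\<infinity>n. jacobi_coeff (w\<^sup>2) (q ^ 4) n) * (2 * euler_prod (q ^ 4) ^ 3))"
  proof -
    have q4: "norm (q ^ 4) < 1" "q ^ 4 \<noteq> 0" using q by (auto intro: norm_power_less_one)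
    let ?J = "jacobi_coeff 1 (q ^ 4)"
    note J = summable_jacobi[OF q4(1) one_neq_zero]
    \<comment> \<open>The part weighted by v is Jacobi's cube and the unweighted part
      vanishes.\<close>
    have "((\<lambda>v. 2 * (of_int v * ?J v) + ?J v) has_sum (2 * euler_prod (q ^ 4) ^ 3 + 0)) UNIV"
      unfolding jacobi_cube[OF q4, symmetric] jacobi_one_zero[OF q4, symmetric]
      by (intro has_sum_add has_sum_cmult_right has_sum_infsum abs_summable_summable[OF J(1)]
            abs_summable_summable[OF J(2)])
    hence sum: "(\<Sum>\<^sub>\<infinity>v. (2 * of_int v + 1) * ?J v) = 2 * euler_prod (q ^ 4) ^ 3"
      by (intro infsumI) (simp add: algebra_simps)
    have "(\<lambda>v. norm ((2 * of_int v + 1) * ?J v)) summable_on UNIV"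
    proof (rule Infinite_Sum.abs_summable_on_comparison_test')
      show "(\<lambda>v. 2 * norm (of_int v * ?J v) + norm (?J v)) summable_on UNIV"
        by (intro summable_on_add summable_on_cmult_right J)
      fix v
      have "(2 * of_int v + 1) * ?J v = 2 * (of_int v * ?J v) + ?J v" by (simp add: algebra_simps)
      thus "norm ((2 * of_int v + 1) * ?J v) \<le> 2 * norm (of_int v * ?J v) + norm (?J v)"
        by (metis norm_triangle_ineq norm_mult norm_numeral)
    qed
    moreover have "(\<lambda>u. norm (jacobi_coeff (w\<^sup>2) (q ^ 4) u)) summable_on UNIV"
      using w by (intro summable_jacobi q4) auto
    ultimately show ?thesis
      using has_sum_cmult_right[OF abs_summable_times(2), of "jacobi_coeff (w\<^sup>2) (q ^ 4)" UNIV
          "\<lambda>v. (2 * of_int v + 1) * ?J v" UNIV "q * w"]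
      by (intro infsumI) (simp add: sum case_prod_unfold)
  qed
  finally show ?thesis by (simp only: mult.assoc)
qed

text \<open>The Wronskian at a primitive cube root of unity \<open>w\<close> is computed twice:
  logarithmic derivatives give \<open>theta w q * theta (- w) q\<close> times the odd Lambert
  series, and \<open>theta_wronskian\<close> gives Euler products, as w^2 is again a cube root of
  unity. The factor 4 is due to \<open>psi2\<close> being 2 psi.\<close>

theorem odd_lambert_eq_psi:
  assumes q: "norm q < 1" "q \<noteq> 0"
  shows "4 * odd_lambert q = q * psi2 (q ^ 2) * psi2 (q ^ 6)"
proof -
  define w where "w = Complex (- 1 / 2) (sqrt 3 / 2)"
  have w3: "w ^ 3 = 1"
    by (simp add: w_def power3_eq_cube complex_eq_iff algebra_simps)
  have w1: "w \<noteq> 1" by (simp add: w_def complex_eq_iff)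
  have w0: "w \<noteq> 0" by (simp add: w_def complex_eq_iff)
  have nw: "norm w = 1" by (simp add: w_def cmod_def power2_eq_square)
  have w6: "(w\<^sup>2) ^ 3 = 1" 
  proof -
    have "(w\<^sup>2) ^ 3 = (w ^ 3)\<^sup>2" by simp
    thus ?thesis using w3 by simp
  qed
  have w2: "w\<^sup>2 \<noteq> 1" using w3 w1 by (auto simp: power2_eq_square power3_eq_cube)
  have k0: "w - 1 / w \<noteq> 0" using w2 w0 by (simp add: field_simps power2_eq_square)
  have n: "norm (q ^ k) < 1" if "k > 0" for k using that q by (intro norm_power_less_one)
  note E0 = euler_prod_nonzero[OF n] and O0 = odd_euler_prod_nonzero[OF n]
  let ?E = "\<lambda>k. euler_prod (q ^ k)"
  have "theta w q * theta (- w) q * (2 * (w - 1 / w) * odd_lambert q)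
      = q * w * ((1 - 1 / w\<^sup>2) * ?E 12) * (2 * ?E 4 ^ 3)"
  proof -
    have "q ^ 4 \<noteq> 0" using q by simp
    from jacobi_cube_root_unity[OF n this w6 w2]
    have J: "(\<Sum>\<^sub>\<infinity>n. jacobi_coeff (w\<^sup>2) (q ^ 4) n) = (1 - 1 / w\<^sup>2) * ?E 12"
      by (simp flip: power_mult)
    have "norm (- w) = 1" using nw by simp
    from theta_wronskian[OF q w0] theta_log_derivative[OF q nw] theta_log_derivative[OF q this]
    have "theta w q * theta (- w) q * (lambert w q - lambert (- w) q)
      = q * w * ((1 - 1 / w\<^sup>2) * ?E 12) * (2 * ?E 4 ^ 3)"
      unfolding J by (simp add: algebra_simps)
    thus ?thesis unfolding lambert_odd_part[OF q w3 nw] .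
  qed
  moreover have "w * (1 - 1 / w\<^sup>2) = w - 1 / w" using w0 by (simp add: field_simps power2_eq_square)
  moreover have "k * (a * L) = k * (q * E * F)"
    if h: "a * (2 * k * L) = q * w * (u * E) * (2 * F)" "w * u = k" for a k L E F u :: complex
  proof -
    have "2 * (k * (a * L)) = 2 * (k * (q * E * F))"
      using h(1) unfolding h(2)[symmetric] by (simp only: mult_ac)
    thus ?thesis by simp
  qed
  ultimately have "(w - 1 / w) * (theta w q * theta (- w) q * odd_lambert q)
      = (w - 1 / w) * (q * ?E 12 * ?E 4 ^ 3)"
    by blast
  hence main: "theta w q * theta (- w) q * odd_lambert q = q * ?E 12 * ?E 4 ^ 3" using k0 by simp
  have "theta w q * theta (- w) q = odd_euler_prod (q ^ 6) / odd_euler_prod (q\<^sup>2) * ?E 2 ^ 2"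
  proof -
    \<comment> \<open>Moving the sign into the second argument makes
      \<open>theta_cube_root_unity\<close> applicable with \<open>- q\<close>.\<close>
    have "theta w q = theta (- w) (- q)" by (simp add: theta_neg)
    also have "\<dots> = odd_euler_prod (- (q ^ 3)) / odd_euler_prod (- q) * ?E 2"
      using theta_cube_root_unity[of "- q" w] q w3 w1 by simp
    finally have "theta w q * theta (- w) q
        = (odd_euler_prod (q ^ 3) * odd_euler_prod (- (q ^ 3)))
          / (odd_euler_prod q * odd_euler_prod (- q)) * ?E 2 ^ 2"
      using theta_cube_root_unity[OF q w3 w1] by (simp add: power2_eq_square mult_ac)
    thus ?thesis using odd_euler_prod_neg[OF n[of 3]] odd_euler_prod_neg[OF q(1)]
      by (simp flip: power_mult)
  qed
  also have "\<dots> = ?E 6 * ?E 4 * ?E 2 / ?E 12"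
  proof -
    have "?E 2 = odd_euler_prod (q\<^sup>2) * ?E 4" "?E 6 = odd_euler_prod (q ^ 6) * ?E 12"
      using euler_prod_split[OF n[of 2]] euler_prod_split[OF n[of 6]] by (simp_all flip: power_mult)
    thus ?thesis using E0[of 12] E0[of 4] O0[of 2] O0[of 6]
      by (simp add: field_simps power2_eq_square)
  qed
  finally have "?E 6 * ?E 4 * ?E 2 / ?E 12 * odd_lambert q = q * ?E 12 * ?E 4 ^ 3"
    using main by simp
  hence "odd_lambert q * (?E 6 * ?E 2) = q * ?E 12 ^ 2 * ?E 4 ^ 2"
    using E0[of 12] E0[of 4] by (simp add: field_simps power2_eq_square power3_eq_cube)
  moreover have "psi2 (q ^ 2) = 2 * ?E 4 ^ 2 / ?E 2" "psi2 (q ^ 6) = 2 * ?E 12 ^ 2 / ?E 6"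
    using psi2_product[OF n[of 2]] psi2_product[OF n[of 6]] q by (simp_all flip: power_mult)
  moreover have "4 * L = q * (2 * b\<^sup>2 / d) * (2 * a\<^sup>2 / c)"
    if "L * (c * d) = q * a\<^sup>2 * b\<^sup>2" "c \<noteq> 0" "d \<noteq> 0" for a b c d L
    using that by (simp add: field_simps)
  ultimately show ?thesis using E0[of 2] E0[of 6] by simp
qed

section \<open>Liouville's identity\<close>

definition odd_quads :: "nat \<Rightarrow> (nat \<times> nat \<times> nat \<times> nat) set" where
  "odd_quads m = {(d, x, e, y). odd d \<and> odd x \<and> odd e \<and> odd y \<and> d * x + e * y = m}"

lemma finite_odd_quads: "finite (odd_quads m)"
proof (rule finite_subset)
  show "odd_quads m \<subseteq> {..m} \<times> {..m} \<times> {..m} \<times> {..m}"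
  proof
    fix t assume "t \<in> odd_quads m"
    moreover obtain d x e y where t: "t = (d, x, e, y)" by (cases t)
    ultimately have *: "d > 0" "x > 0" "e > 0" "y > 0" "d * x + e * y = m"
      by (auto simp: odd_quads_def odd_pos)
    hence "d \<le> d * x" "x \<le> d * x" "e \<le> e * y" "y \<le> e * y" by auto
    thus "t \<in> {..m} \<times> {..m} \<times> {..m} \<times> {..m}"
      using *(5) unfolding t mem_Sigma_iff atMost_iff by linarith
  qed
qed auto

definition dual_quad :: "nat \<times> nat \<times> nat \<times> nat \<Rightarrow> nat \<times> nat \<times> nat \<times> nat" where
  "dual_quad = (\<lambda>(d, x, e, y). (x, d, y, e))"

text \<open>
  With \<open>a = d - e\<close> and \<open>f = x + y\<close> the equation \<open>d x + e y = m\<close> reads \<open>a x + e f = m\<close>; moving the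
  multiple of \<open>a\<close> contained in \<open>e\<close> over to \<open>x\<close> gives \<open>a y' + d' f = m\<close> with \<open>d' < a\<close>.
\<close>

definition liouville_map :: "nat \<times> nat \<times> nat \<times> nat \<Rightarrow> nat \<times> nat \<times> nat \<times> nat" where
  "liouville_map = (\<lambda>(d, x, e, y). let a = d - e; f = x + y; y' = x + (e div a) * f in
     (e mod a, y' + f, a - e mod a, y'))"

lemma dual_quad_dual_quad [simp]: "dual_quad (dual_quad t) = t"
  by (cases t) (simp add: dual_quad_def)

definition quads_gt1 :: "nat \<Rightarrow> (nat \<times> nat \<times> nat \<times> nat) set" where
  "quads_gt1 m = {(d, x, e, y) \<in> odd_quads m. d > e}"

definition quads_gt2 :: "nat \<Rightarrow> (nat \<times> nat \<times> nat \<times> nat) set" where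
  "quads_gt2 m = {(d, x, e, y) \<in> odd_quads m. x > y}"

lemma dual_quad_gt:
  "t \<in> quads_gt2 m \<Longrightarrow> dual_quad t \<in> quads_gt1 m"
  "t \<in> quads_gt1 m \<Longrightarrow> dual_quad t \<in> quads_gt2 m"
  by (auto simp: quads_gt1_def quads_gt2_def odd_quads_def dual_quad_def mult.commute)

text \<open>Conjugation by \<open>dual_quad\<close> inverts the map: dividing e by a = d - e is
  undone by dividing y' by f = x + y, which recovers the quotient k and the remainder x because x <
  f.\<close>

lemma liouville_map_gt:
  assumes "t \<in> quads_gt1 m"
  shows "liouville_map t \<in> quads_gt2 m"
    and "dual_quad (liouville_map (dual_quad (liouville_map t))) = t"
    and "(case liouville_map t of (d, x, e, y) \<Rightarrow> int d + int e) = (case t of (d, x, e, y) \<Rightarrow> int d - int e)"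
proof -
  obtain d x e y where t: "t = (d, x, e, y)" by (cases t)
  have *: "odd d" "odd x" "odd e" "odd y" "d * x + e * y = m" "d > e"
    using assms by (auto simp: t quads_gt1_def odd_quads_def)
  define a f k r where "a = d - e" and "f = x + y" and "k = e div a" and "r = e mod a"
  have a: "a > 0" "even a" "d = e + a" using * by (auto simp: a_def)
  have f: "f > 0" "even f" "x < f" "y = f - x" using * by (auto simp: f_def odd_pos)
  have e: "e = r + k * a" by (simp add: k_def r_def)
  \<comment> \<open>As \<open>a\<close> is even and \<open>e\<close> odd, the remainder is odd,
    hence positive; the same then holds for \<open>a - r\<close>.\<close>
  have r: "r < a" "odd r" using a * by (auto simp: r_def dvd_mod_iff)
  have img: "liouville_map t = (r, x + k * f + f, a - r, x + k * f)"
    by (simp add: liouville_map_def t a_def f_def k_def r_def Let_def)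
  have "m = a * x + e * f"
    using *(5) a(3) by (simp add: f_def algebra_simps)
  also have "\<dots> = r * (x + k * f + f) + (a - r) * (x + k * f)"
  proof -
    have "r * (x + k * f + f) + (a - r) * (x + k * f) = (r + (a - r)) * (x + k * f) + r * f"
      by (simp add: algebra_simps)
    thus ?thesis using r e by (simp add: algebra_simps)
  qed
  finally show "liouville_map t \<in> quads_gt2 m"
    using r a f * unfolding img quads_gt2_def odd_quads_def by auto
  have div: "(x + k * f) div f = k" "(x + k * f) mod f = x" using f by auto
  have "liouville_map (dual_quad (liouville_map t)) = (x, r + k * a + a, f - x, r + k * a)"
  proof -
    have dual: "dual_quad (liouville_map t) = (x + k * f + f, r, x + k * f, a - r)"
      by (simp add: img dual_quad_def)
    have "x + k * f + f - (x + k * f) = f" "r + (a - r) = a" using r by simp_all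
    thus ?thesis unfolding dual by (simp add: liouville_map_def Let_def div f(3))
  qed
  thus "dual_quad (liouville_map (dual_quad (liouville_map t))) = t"
    using e a f by (simp add: dual_quad_def t)
  show "(case liouville_map t of (d, x, e, y) \<Rightarrow> int d + int e) = (case t of (d, x, e, y) \<Rightarrow> int d - int e)"
    using r a by (simp add: img) (simp add: t)
qed

lemma sum_quads_gt:
  fixes F :: "int \<Rightarrow> int"
  shows "(\<Sum>(d, x, e, y)\<in>quads_gt1 m. F (int d - int e)) = (\<Sum>(d, x, e, y)\<in>quads_gt2 m. F (int d + int e))"
proof (rule sum.reindex_bij_witness[of _ "dual_quad \<circ> liouville_map \<circ> dual_quad" liouville_map])
  fix t assume t: "t \<in> quads_gt1 m"
  show "(dual_quad \<circ> liouville_map \<circ> dual_quad) (liouville_map t) = t" "liouville_map t \<in> quads_gt2 m"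
    using liouville_map_gt[OF t] by simp_all
  show "(case liouville_map t of (d, x, e, y) \<Rightarrow> F (int d + int e)) = (case t of (d, x, e, y) \<Rightarrow> F (int d - int e))"
    using arg_cong[OF liouville_map_gt(3)[OF t], of F] by (simp add: case_prod_unfold)
next
  fix t assume t: "t \<in> quads_gt2 m"
  show "liouville_map ((dual_quad \<circ> liouville_map \<circ> dual_quad) t) = t"
    using arg_cong[OF liouville_map_gt(2)[OF dual_quad_gt(1)[OF t]], of dual_quad] by simp
  show "(dual_quad \<circ> liouville_map \<circ> dual_quad) t \<in> quads_gt1 m"
    using t by (simp add: dual_quad_gt liouville_map_gt)
qed

text \<open>For x = y the equation is x (d + e) = 2 N, so D = (d + e) / 2 divides N and x = N / D,
  which is odd as N is. For each D there remain the D odd values of d below 2 D.\<close>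

lemma sum_quads_eq:
  fixes g :: "nat \<Rightarrow> int"
  assumes "odd N"
  shows "(\<Sum>(d, x, e, y)\<in>{(d, x, e, y) \<in> odd_quads (2 * N). x = y}. g (d + e))
       = (\<Sum>D | D dvd N. int D * g (2 * D))"
proof -
  have N: "N > 0" using assms by (auto simp: odd_pos)
  have "(\<Sum>(d, x, e, y)\<in>{(d, x, e, y) \<in> odd_quads (2 * N). x = y}. g (d + e))
      = (\<Sum>(D, d)\<in>Sigma {D. D dvd N} (\<lambda>D. {d. odd d \<and> d < 2 * D}). g (2 * D))"
  proof (rule sum.reindex_bij_witness[of _ "\<lambda>(D, d). (d, N div D, 2 * D - d, N div D)"
            "\<lambda>(d, x, e, y). ((d + e) div 2, d)"], goal_cases)
    case (1 t)
    obtain d x e y where t: "t = (d, x, e, y)" by (cases t)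
    have *: "odd d" "odd x" "odd e" "y = x" "d * x + e * x = 2 * N"
      using 1 by (auto simp: t odd_quads_def)
    obtain D where D: "d + e = 2 * D" using * by (metis even_add evenE)
    hence "D * x = N" using *(5) by (metis add_mult_distrib mult.assoc mult_cancel1 zero_neq_numeral)
    moreover have "D > 0" using \<open>D * x = N\<close> N by (cases D) auto
    ultimately have "N div D = x" by auto
    thus ?case using D * by (simp add: t)
  next
    case (2 t)
    obtain d x e y where t: "t = (d, x, e, y)" by (cases t)
    have *: "odd d" "odd x" "odd e" "y = x" "d * x + e * x = 2 * N"
      using 2 by (auto simp: t odd_quads_def)
    obtain D where D: "d + e = 2 * D" using * by (metis even_add evenE)
    hence "D * x = N" using *(5) by (metis add_mult_distrib mult.assoc mult_cancel1 zero_neq_numeral)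
    moreover have "d < 2 * D" using D * by (auto simp: odd_pos simp flip: D)
    ultimately show ?case using D * by (auto simp: t)
  next
    case (4 p)
    obtain D d where p: "p = (D, d)" by force
    have *: "D dvd N" "odd d" "d < 2 * D" using 4 by (auto simp: p)
    then obtain c where c: "N = D * c" by blast
    have "D > 0" "odd c" using * c assms by auto
    moreover have "d * c + (2 * D - d) * c = 2 * N"
      using *(3) c by (simp flip: add_mult_distrib)
    ultimately show ?case using * c by (auto simp: p odd_quads_def)
  next
    case (5 t)
    obtain d x e y where t: "t = (d, x, e, y)" by (cases t)
    have "odd d" "odd e" using 5 by (auto simp: t odd_quads_def)
    thus ?case by (simp add: t)
  qed auto
  also have "\<dots> = (\<Sum>D | D dvd N. \<Sum>d | odd d \<and> d < 2 * D. g (2 * D))"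
    using N by (subst sum.Sigma) auto
  also have "\<dots> = (\<Sum>D | D dvd N. int D * g (2 * D))"
  proof (rule sum.cong)
    fix D :: nat
    have "{d. odd d \<and> d < 2 * D} = (\<lambda>i. 2 * i + 1) ` {..<D}"
      by (auto elim!: oddE)
    hence "card {d. odd d \<and> d < 2 * D} = D" by (simp add: card_image inj_on_def)
    thus "(\<Sum>d | odd d \<and> d < 2 * D. g (2 * D)) = int D * g (2 * D)" by simp
  qed auto
  finally show ?thesis .
qed

text \<open>The first sum is split by comparing d with e, the second by comparing x with y. Swapping
  the two products doubles the strict parts, where evenness of F enters; these cancel by
  \<open>sum_quads_gt\<close>. The diagonals d = e and x = y correspond under
  \<open>dual_quad\<close>, and \<open>sum_quads_eq\<close> evaluates them.\<close>

theorem liouville_identity: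
  fixes F :: "int \<Rightarrow> int"
  assumes "odd N" and even_F: "\<And>k. F (- k) = F k"
  shows "(\<Sum>(d, x, e, y)\<in>odd_quads (2 * N). F (int d - int e) - F (int d + int e))
       = (\<Sum>D | D dvd N. int D * (F 0 - F (2 * int D)))"
proof -
  let ?S = "odd_quads (2 * N)"
  let ?f = "\<lambda>(d, x, e, y). F (int d - int e)" and ?g = "\<lambda>(d, x, e, y). F (int d + int e)"
  let ?eq1 = "{(d, x, e, y) \<in> ?S. d = e}" and ?eq2 = "{(d, x, e, y) \<in> ?S. x = y}"
  let ?lt1 = "{(d, x, e, y) \<in> ?S. d < e}" and ?lt2 = "{(d, x, e, y) \<in> ?S. x < y}"
  let ?gt1 = "quads_gt1 (2 * N)" and ?gt2 = "quads_gt2 (2 * N)"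
  have fin: "finite A" if "A \<subseteq> ?S" for A
    using finite_odd_quads that by (rule rev_finite_subset)
  have sw: "sum h A = sum h' B"
    if "\<And>d x e y. (d, x, e, y) \<in> A \<longleftrightarrow> (e, y, d, x) \<in> B" "\<And>d x e y. h (d, x, e, y) = h' (e, y, d, x)"
    for h h' :: "_ \<Rightarrow> int" and A B
    by (rule sum.reindex_bij_witness[of _ "\<lambda>(d, x, e, y). (e, y, d, x)" "\<lambda>(d, x, e, y). (e, y, d, x)"])
       (use that in auto)
  have mem: "(e, y, d, x) \<in> ?S \<longleftrightarrow> (d, x, e, y) \<in> ?S" for d x e y
    by (auto simp: odd_quads_def add.commute)
  have "?S = ?eq1 \<union> (?gt1 \<union> ?lt1)" by (auto simp: quads_gt1_def)
  hence "sum ?f ?S = sum ?f (?eq1 \<union> (?gt1 \<union> ?lt1))" by simp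
  also have "\<dots> = sum ?f ?eq1 + (sum ?f ?gt1 + sum ?f ?lt1)"
    by (subst sum.union_disjoint; (subst sum.union_disjoint)?) (auto simp: quads_gt1_def intro!: fin)
  also have "sum ?f ?lt1 = sum ?f ?gt1"
  proof (rule sw)
    show "(case (d, x, e, y) of (d, x, e, y) \<Rightarrow> F (int d - int e)) = (case (e, y, d, x) of (d, x, e, y) \<Rightarrow> F (int d - int e))"
      for d x e y :: nat using even_F[of "int d - int e"] by simp
  qed (auto simp: quads_gt1_def mem)
  finally have f: "sum ?f ?S = sum ?f ?eq1 + 2 * sum ?f ?gt1" by simp
  have "?S = ?eq2 \<union> (?gt2 \<union> ?lt2)" by (auto simp: quads_gt2_def)
  hence "sum ?g ?S = sum ?g (?eq2 \<union> (?gt2 \<union> ?lt2))" by simp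
  also have "\<dots> = sum ?g ?eq2 + (sum ?g ?gt2 + sum ?g ?lt2)"
    by (subst sum.union_disjoint; (subst sum.union_disjoint)?) (auto simp: quads_gt2_def intro!: fin)
  also have "sum ?g ?lt2 = sum ?g ?gt2"
    by (rule sw) (auto simp: quads_gt2_def mem add.commute)
  finally have g: "sum ?g ?S = sum ?g ?eq2 + 2 * sum ?g ?gt2" by simp
  have "sum ?f ?eq1 = (\<Sum>(d, x, e, y)\<in>?eq2. F 0)"
    by (rule sum.reindex_bij_witness[of _ dual_quad dual_quad])
       (auto simp: dual_quad_def odd_quads_def mult.commute)
  also have "\<dots> = (\<Sum>D | D dvd N. int D * F 0)"
    using sum_quads_eq[OF assms(1), of "\<lambda>_. F 0"] by simp
  finally have eq1: "sum ?f ?eq1 = (\<Sum>D | D dvd N. int D * F 0)" .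
  have eq2: "sum ?g ?eq2 = (\<Sum>D | D dvd N. int D * F (2 * int D))"
    using sum_quads_eq[OF assms(1), of "\<lambda>k. F (int k)"] by simp
  have "(\<Sum>(d, x, e, y)\<in>?S. F (int d - int e) - F (int d + int e)) = sum ?f ?S - sum ?g ?S"
    by (simp add: case_prod_unfold sum_subtractf)
  also have "\<dots> = (\<Sum>D | D dvd N. int D * F 0) - (\<Sum>D | D dvd N. int D * F (2 * int D))"
    unfolding f g sum_quads_gt eq1 eq2 by simp
  finally show ?thesis by (simp add: right_diff_distrib sum_subtractf)
qed

text \<open>Liouville's identity for the indicator of the multiples of 3:
  \<open>F 0 - F (2 * int D)\<close> is 1 exactly when 3 does not divide D, and the divisors of N
  prime to 3 are those of \<open>n1\<close>.\<close>

lemma sum_chi3_odd_quads: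
  assumes "odd N" "N = 3 ^ \<beta> * n1" "\<not> 3 dvd n1"
  shows "(\<Sum>(d, x, e, y)\<in>odd_quads (2 * N). chi3 d * chi3 e) = int (divisor_sigma n1)"
proof -
  define F :: "int \<Rightarrow> int" where "F k = (if 3 dvd k then 1 else 0)" for k
  have "chi3 d * chi3 e = F (int d - int e) - F (int d + int e)" for d e
  proof -
    have "d mod 3 = 0 \<or> d mod 3 = 1 \<or> d mod 3 = 2" "e mod 3 = 0 \<or> e mod 3 = 1 \<or> e mod 3 = 2" by auto
    moreover have "3 dvd (int d - int e) \<longleftrightarrow> d mod 3 = e mod 3" by presburger
    moreover have "3 dvd (int d + int e) \<longleftrightarrow> (d mod 3 + e mod 3) mod 3 = 0" by presburger
    ultimately show ?thesis unfolding F_def chi3_def by auto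
  qed
  hence "(\<Sum>(d, x, e, y)\<in>odd_quads (2 * N). chi3 d * chi3 e)
      = (\<Sum>D | D dvd N. int D * (F 0 - F (2 * int D)))"
    using liouville_identity[OF assms(1), of F] by (simp add: F_def)
  also have "\<dots> = (\<Sum>D | D dvd n1. int D)"
  proof (rule sum.mono_neutral_cong_right)
    have "N > 0" using assms(1) by (simp add: odd_pos)
    thus "finite {D. D dvd N}" by simp
    show "{D. D dvd n1} \<subseteq> {D. D dvd N}" using assms(2) by auto
    have F2: "F (2 * int D) = (if 3 dvd D then 1 else 0)" for D unfolding F_def by presburger
    show "\<forall>D\<in>{D. D dvd N} - {D. D dvd n1}. int D * (F 0 - F (2 * int D)) = 0"
    proof
      fix D assume D: "D \<in> {D. D dvd N} - {D. D dvd n1}"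
      have "3 dvd D"
      proof (rule ccontr)
        assume "\<not> 3 dvd D"
        hence "coprime 3 D" by (intro prime_imp_coprime) auto
        hence "coprime D (3 ^ \<beta>)" by (simp add: coprime_commute)
        thus False using D assms(2) by (auto simp: coprime_dvd_mult_right_iff)
      qed
      thus "int D * (F 0 - F (2 * int D)) = 0" by (simp add: F2) (simp add: F_def)
    qed
    fix D assume "D \<in> {D. D dvd n1}"
    hence "\<not> 3 dvd D" using assms(3) dvd_trans by blast
    thus "int D * (F 0 - F (2 * int D)) = int D" by (simp add: F2) (simp add: F_def)
  qed
  finally show ?thesis by (simp add: divisor_sigma_def)
qed

section \<open>Dissections and generating functions\<close>

lemma summable_psi2: "norm q < 1 \<Longrightarrow> (\<lambda>n. norm (q ^ tri n :: complex)) summable_on UNIV"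
  using abs_summable_tri(2)[of 1 q] by simp

lemma summable_phi:
  fixes q :: complex
  assumes "norm q < 1" "q \<noteq> 0"
  shows "(\<lambda>n :: int. norm (q ^ nat (n\<^sup>2))) summable_on UNIV"
  using summable_theta(2)[OF assms one_neq_zero] by simp

text \<open>Even and odd n are separated: (2k)^2 = 4 k^2 and (2k + 1)^2 = 1 + 8 tri(k).\<close>

lemma phi_parity:
  assumes "norm q < 1" "q \<noteq> 0"
  shows "phi q = phi (q ^ 4) + q * psi2 (q ^ 8)"
proof -
  let ?f = "\<lambda>n :: int. q ^ nat (n\<^sup>2)"
  have summ: "?f summable_on A" for A
    using summable_on_subset_banach[OF abs_summable_summable[OF summable_phi[OF assms]]] by blast
  have "phi q = infsum ?f (Collect even \<union> Collect odd)"
    unfolding phi_def by (rule arg_cong[where f = "infsum ?f"]) auto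
  also have "\<dots> = infsum ?f (Collect even) + infsum ?f (Collect odd)"
    by (rule infsum_Un_disjoint) (auto intro: summ)
  also have "infsum ?f (Collect even) = (\<Sum>\<^sub>\<infinity>k :: int. (q ^ 4) ^ nat (k\<^sup>2))"
    by (rule infsum_reindex_bij_witness[of _ "\<lambda>k. 2 * k" "\<lambda>n. n div 2"])
       (auto elim!: evenE simp: power_mult_distrib nat_mult_distrib simp flip: power_mult)
  also have "infsum ?f (Collect odd) = (\<Sum>\<^sub>\<infinity>k. q * (q ^ 8) ^ tri k)"
  proof (rule infsum_reindex_bij_witness[of _ "\<lambda>k. 2 * k + 1" "\<lambda>n. n div 2"])
    fix n :: int assume "n \<in> Collect odd"
    then obtain k where k: "n = 2 * k + 1" by (auto elim: oddE)
    have "int (nat (n\<^sup>2)) = int (1 + 8 * tri k)"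
      using two_tri[of k] by (simp add: k power2_eq_square algebra_simps)
    hence "nat (n\<^sup>2) = 1 + 8 * tri k" by (simp only: of_nat_eq_iff)
    thus "q * (q ^ 8) ^ tri (n div 2) = q ^ nat (n\<^sup>2)" by (simp add: k power_mult)
  qed auto
  finally show ?thesis by (simp add: phi_def psi2_def infsum_cmult_right')
qed

text \<open>
  On the pairs with \<open>m + n\<close> even, \<open>2 m + 1 = a + 3 b\<close> and \<open>2 n + 1 = a - b\<close> turn
  \<open>(2 m + 1)\<^sup>2 + 3 (2 n + 1)\<^sup>2\<close> into \<open>4 (a\<^sup>2 + 3 b\<^sup>2)\<close> with \<open>a + b\<close> odd.
\<close>

lemma phi_odd_part:
  fixes q :: complex
  assumes "norm q < 1" "q \<noteq> 0"
  shows "phi q * phi (q ^ 3) - phi (- q) * phi (- (q ^ 3)) = q * psi2 (q ^ 2) * psi2 (q ^ 6)"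
proof -
  have n: "norm (q ^ k) < 1" "norm (- (q ^ k)) < 1" "q ^ k \<noteq> 0" "- (q ^ k) \<noteq> 0" if "k > 0" for k
    using that assms norm_power_less_one[of q k] by auto
  let ?Ev = "{(a :: int, b :: int). even (a + b)}" and ?Od = "{(a :: int, b :: int). odd (a + b)}"
  let ?f = "\<lambda>(a :: int, b :: int). q ^ nat (a\<^sup>2) * (q ^ 3) ^ nat (b\<^sup>2)"
  let ?g = "\<lambda>(a :: int, b :: int). (- q) ^ nat (a\<^sup>2) * (- (q ^ 3)) ^ nat (b\<^sup>2)"
  let ?h = "\<lambda>(m, n). q * ((q ^ 2) ^ tri m * (q ^ 6) ^ tri n)"
  have f: "(?f has_sum (phi q * phi (q ^ 3))) (UNIV \<times> UNIV)"
    unfolding phi_def using n(1,3)[of 3] assms by (intro abs_summable_times(2) summable_phi) auto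
  have g: "(?g has_sum (phi (- q) * phi (- (q ^ 3)))) (UNIV \<times> UNIV)"
    unfolding phi_def using n(2,4)[of 3] assms by (intro abs_summable_times(2) summable_phi) auto
  have "((\<lambda>(m, n). (q ^ 2) ^ tri m * (q ^ 6) ^ tri n) has_sum (psi2 (q ^ 2) * psi2 (q ^ 6))) (UNIV \<times> UNIV)"
    unfolding psi2_def using n by (intro abs_summable_times(2) summable_psi2) auto
  from has_sum_cmult_right[OF this, of q]
  have h: "(?h has_sum (q * psi2 (q ^ 2) * psi2 (q ^ 6))) UNIV"
    by (simp add: case_prod_unfold mult.assoc)
  have summ: "?f summable_on A" "?h summable_on A" for A
    using summable_on_subset_banach[OF has_sum_imp_summable[OF f]]
      summable_on_subset_banach[OF has_sum_imp_summable[OF h]] by auto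
  have "((\<lambda>x. ?f x - ?g x) has_sum (phi q * phi (q ^ 3) - phi (- q) * phi (- (q ^ 3)))) UNIV"
    using has_sum_diff[OF f g] by simp
  \<comment> \<open>Negating both bases multiplies the term at (a, b) by (-1)^(a + b), so the
    difference doubles the pairs with a + b odd.\<close>
  moreover have "?f x - ?g x = (if x \<in> ?Od then 2 * ?f x else 0)" for x
    by (cases x) (auto simp: power_square_neg power_int_minus_left)
  ultimately have "((\<lambda>x. if x \<in> ?Od then 2 * ?f x else 0)
      has_sum (phi q * phi (q ^ 3) - phi (- q) * phi (- (q ^ 3)))) UNIV" by (simp only:)
  also have "?this \<longleftrightarrow> ((\<lambda>x. 2 * ?f x) has_sum (phi q * phi (q ^ 3) - phi (- q) * phi (- (q ^ 3)))) ?Od"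
    by (rule has_sum_cong_neutral) auto
  finally have "((\<lambda>x. 2 * ?f x) has_sum (phi q * phi (q ^ 3) - phi (- q) * phi (- (q ^ 3)))) ?Od" .
  from infsumI[OF this]
  have lhs: "phi q * phi (q ^ 3) - phi (- q) * phi (- (q ^ 3)) = 2 * infsum ?f ?Od"
    unfolding infsum_cmult_right' by (rule sym)
  have "q * psi2 (q ^ 2) * psi2 (q ^ 6) = infsum ?h UNIV" using h by (simp add: infsumI)
  also have "\<dots> = infsum ?h (?Ev \<union> ?Od)" by (rule arg_cong[where f = "infsum ?h"]) auto
  also have "\<dots> = infsum ?h ?Ev + infsum ?h ?Od"
    by (rule infsum_Un_disjoint) (auto intro: summ)
  \<comment> \<open>Reflecting n to -1 - n preserves tri(n) and flips the parity of m + n.\<close>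
  also have "infsum ?h ?Od = infsum ?h ?Ev"
    by (rule infsum_reindex_bij_witness[of _ "\<lambda>(m, n). (m, - 1 - n)" "\<lambda>(m, n). (m, - 1 - n)"])
       (auto simp: tri_reflect)
  also have "infsum ?h ?Ev = infsum ?f ?Od"
  proof (rule infsum_reindex_bij_witness[of _ "\<lambda>(a, b). ((a + 3 * b - 1) div 2, (a - b - 1) div 2)"
          "\<lambda>(m, n). ((m + 3 * n + 2) div 2, (m - n) div 2)"], goal_cases)
    case (1 x)
    obtain m n where x: "x = (m, n)" by force
    have "even (m + n)" using 1 by (simp add: x)
    then obtain k where k: "m + n = 2 * k" by (elim evenE)
    hence div: "(m + 3 * n + 2) div 2 = k + n + 1" "(m - n) div 2 = k - n" by presburger+
    show ?case unfolding x prod.case div using k by simp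
  next
    case (2 x)
    obtain m n where x: "x = (m, n)" by force
    have "even (m + n)" using 2 by (simp add: x)
    then obtain k where k: "m + n = 2 * k" by (elim evenE)
    hence div: "(m + 3 * n + 2) div 2 = k + n + 1" "(m - n) div 2 = k - n" by presburger+
    show ?case unfolding x prod.case div using k by simp
  next
    case (3 x)
    obtain a b where x: "x = (a, b)" by force
    have "odd (a + b)" using 3 by (simp add: x)
    then obtain k where k: "a + b = 2 * k + 1" by (elim oddE)
    hence div: "(a + 3 * b - 1) div 2 = k + b" "(a - b - 1) div 2 = k - b" by presburger+
    show ?case unfolding x prod.case div using k by simp
  next
    case (4 x)
    obtain a b where x: "x = (a, b)" by force
    have "odd (a + b)" using 4 by (simp add: x)
    then obtain k where k: "a + b = 2 * k + 1" by (elim oddE)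
    hence div: "(a + 3 * b - 1) div 2 = k + b" "(a - b - 1) div 2 = k - b" by presburger+
    show ?case unfolding x prod.case div using k by simp
  next
    case (5 x)
    obtain m n where x: "x = (m, n)" by force
    have "even (m + n)" using 5 by (simp add: x)
    then obtain k where k: "m + n = 2 * k" by (elim evenE)
    hence ab: "(m + 3 * n + 2) div 2 = k + n + 1" "(m - n) div 2 = k - n" by presburger+
    have m: "m = 2 * k - n" using k by simp
    have "(k + n + 1)\<^sup>2 + 3 * (k - n)\<^sup>2 = 1 + 2 * int (tri m) + 6 * int (tri n)"
      using two_tri[of m] two_tri[of n] by (simp add: m power2_eq_square algebra_simps)
    hence "int (nat ((k + n + 1)\<^sup>2) + 3 * nat ((k - n)\<^sup>2)) = int (1 + 2 * tri m + 6 * tri n)"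
      by simp
    hence "nat ((k + n + 1)\<^sup>2) + 3 * nat ((k - n)\<^sup>2) = 1 + 2 * tri m + 6 * tri n"
      by (simp only: of_nat_eq_iff)
    hence "q ^ (nat ((k + n + 1)\<^sup>2) + 3 * nat ((k - n)\<^sup>2)) = q ^ (1 + 2 * tri m + 6 * tri n)"
      by (simp only:)
    thus ?case unfolding x prod.case ab by (simp add: power_add power_mult)
  qed
  finally show ?thesis using lhs by simp
qed

text \<open>Both sides are written through \<open>odd_euler_prod\<close> at \<open>q\<close> and
  \<open>- q\<close> and \<open>euler_prod (q ^ 4)\<close>.\<close>

lemma psi2_square:
  assumes "norm q < 1" "q \<noteq> 0"
  shows "psi2 q ^ 2 = 2 * phi q * psi2 (q ^ 2)"
proof -
  have n: "norm (q ^ k) < 1" if "k > 0" for k using that assms by (intro norm_power_less_one)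
  let ?O = odd_euler_prod and ?E = euler_prod
  have E1: "?E q = ?O q * ?E (q\<^sup>2)" by (rule euler_prod_split[OF assms(1)])
  have E2: "?E (q\<^sup>2) = ?O q * ?O (- q) * ?E (q ^ 4)"
    using euler_prod_split[OF n[of 2]] odd_euler_prod_neg[OF assms(1)] by (simp flip: power_mult)
  have nz: "?O q \<noteq> 0" "?O (- q) \<noteq> 0" "?E (q ^ 4) \<noteq> 0"
    using assms n by (auto intro!: odd_euler_prod_nonzero euler_prod_nonzero)
  have "psi2 q = 2 * ?O (- q) * ?E (q ^ 4)"
    using psi2_product[OF assms] nz unfolding E1 E2 by (simp add: field_simps power2_eq_square)
  moreover have "phi q = ?O (- q) ^ 2 * ?E (q\<^sup>2)"
    using phi_neg_product[of "- q"] assms by simp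
  moreover have "psi2 (q ^ 2) = 2 * ?E (q ^ 4) ^ 2 / ?E (q\<^sup>2)"
    using psi2_product[OF n[of 2]] assms by (simp flip: power_mult)
  moreover have "?E (q\<^sup>2) \<noteq> 0" by (intro euler_prod_nonzero n) auto
  ultimately show ?thesis by (simp add: power_mult_distrib)
qed

text \<open>The eta product at \<open>\<i> * q ^ 2\<close> consists of two such pairs, with q^4 and
  q^12 in place of \<open>q\<close>; this turns it into theta functions.\<close>

lemma euler_pair_psi_phi:
  assumes "norm q < 1" "q \<noteq> 0"
  shows "2 * euler_prod (- q) * euler_prod (q ^ 2) = psi2 q * phi (- (q ^ 2))"
proof -
  have n: "norm (q ^ k) < 1" if "k > 0" for k using that assms by (intro norm_power_less_one)
  let ?O = odd_euler_prod and ?E = euler_prod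
  have E1: "?E q = ?O q * ?E (q\<^sup>2)" by (rule euler_prod_split[OF assms(1)])
  have E1': "?E (- q) = ?O (- q) * ?E (q\<^sup>2)" using euler_prod_split[of "- q"] assms by simp
  have O2: "?O (q\<^sup>2) = ?O q * ?O (- q)" using odd_euler_prod_neg[OF assms(1)] by simp
  have E2: "?E (q\<^sup>2) = ?O (q\<^sup>2) * ?E (q ^ 4)"
    using euler_prod_split[OF n[of 2]] by (simp flip: power_mult)
  have nz: "?O q \<noteq> 0" "?E (q\<^sup>2) \<noteq> 0"
    using assms n by (auto intro!: odd_euler_prod_nonzero euler_prod_nonzero)
  have "phi (- (q ^ 2)) = ?O (q\<^sup>2) ^ 2 * ?E (q ^ 4)"
    using phi_neg_product[OF n[of 2]] assms by (simp flip: power_mult)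
  hence phi: "phi (- (q ^ 2)) = ?O q * ?O (- q) * ?E (q\<^sup>2)"
    using E2 O2 by (simp add: power2_eq_square)
  have psi: "psi2 q = 2 * ?E (q\<^sup>2) / ?O q"
    using psi2_product[OF assms] nz unfolding E1 by (simp add: power2_eq_square)
  show ?thesis unfolding phi psi E1' using nz by simp
qed

section \<open>Power series whose coefficients count representations\<close>

lemma has_sum_group_powers:
  fixes c :: "'a \<Rightarrow> complex"
  assumes "((\<lambda>x. c x * q ^ e x) has_sum S) A" "\<And>n. finite {x \<in> A. e x = n}"
  shows "((\<lambda>n. (\<Sum>x | x \<in> A \<and> e x = n. c x) * q ^ n) has_sum S) UNIV"
proof -
  have "((\<lambda>(n, x). c x * q ^ e x) has_sum S) (SIGMA n:UNIV. {x \<in> A. e x = n})"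
    using assms(1)
    by (subst has_sum_reindex_bij_witness[of _ "\<lambda>x. (e x, x)" snd A "\<lambda>x. c x * q ^ e x"]) auto
  thus ?thesis
  proof (rule has_sum_SigmaD)
    fix n
    show "((\<lambda>x. case (n, x) of (n, x) \<Rightarrow> c x * q ^ e x) has_sum
        (\<Sum>x | x \<in> A \<and> e x = n. c x) * q ^ n) {x \<in> A. e x = n}"
      by (rule has_sum_finiteI) (use assms(2) in \<open>auto simp: sum_distrib_right intro!: sum.cong\<close>)
  qed
qed

lemma odd_lambert_square_sums:
  assumes "norm q < 1" "q \<noteq> 0"
  shows "(\<lambda>m. of_int (\<Sum>(d, x, e, y)\<in>odd_quads m. chi3 d * chi3 e) * q ^ m) sums (odd_lambert q ^ 2)"
proof -
  let ?A = "Collect odd \<times> Collect odd :: (nat \<times> nat) set"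
  let ?f = "\<lambda>(d, x). of_int (chi3 d) * q ^ (d * x)"
  let ?B = "{(d, x, e, y). odd d \<and> odd x \<and> odd e \<and> odd y} :: (nat \<times> nat \<times> nat \<times> nat) set"
  have S: "(\<lambda>p. norm (?f p)) summable_on ?A"
    using summable_odd_lambert[OF assms] by (simp add: case_prod_unfold)
  have "((\<lambda>(p, p'). ?f p * ?f p') has_sum (odd_lambert q ^ 2)) (?A \<times> ?A)"
    using abs_summable_times(2)[OF S S] by (simp add: odd_lambert_def power2_eq_square)
  also have "?this \<longleftrightarrow> ((\<lambda>t. (case t of (d, x, e, y) \<Rightarrow> of_int (chi3 d * chi3 e)) *
      q ^ (case t of (d, x, e, y) \<Rightarrow> d * x + e * y)) has_sum (odd_lambert q ^ 2)) ?B"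
    by (rule has_sum_reindex_bij_witness[of _ "\<lambda>(d, x, e, y). ((d, x), (e, y))"
          "\<lambda>((d, x), (e, y)). (d, x, e, y)"]) (auto simp: power_add)
  finally have B: "((\<lambda>t. (case t of (d, x, e, y) \<Rightarrow> of_int (chi3 d * chi3 e)) *
      q ^ (case t of (d, x, e, y) \<Rightarrow> d * x + e * y)) has_sum (odd_lambert q ^ 2)) ?B" .
  have "{t \<in> ?B. (case t of (d, x, e, y) \<Rightarrow> d * x + e * y) = m} = odd_quads m" for m
    by (auto simp: odd_quads_def)
  from has_sum_group_powers[OF B] this finite_odd_quads
  have "((\<lambda>m. (\<Sum>t\<in>odd_quads m. case t of (d, x, e, y) \<Rightarrow> of_int (chi3 d * chi3 e)) * q ^ m)
      has_sum (odd_lambert q ^ 2)) UNIV" by simp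
  moreover have "of_int (\<Sum>(d, x, e, y)\<in>odd_quads m. chi3 d * chi3 e)
      = (\<Sum>t\<in>odd_quads m. (case t of (d, x, e, y) \<Rightarrow> (of_int (chi3 d * chi3 e) :: complex)))" for m
    by (simp add: of_int_sum case_prod_unfold)
  ultimately show ?thesis using has_sum_imp_sums by (simp only:)
qed

text \<open>Every integer k satisfies k <= tri(k); this is applied to \<open>n\<close> and to its
  reflection \<open>- 1 - n\<close>.\<close>

lemma tri_le_bounds:
  assumes "tri n \<le> N"
  shows "n \<in> {- 1 - int N..int N}"
proof -
  have "k \<le> int (tri k)" for k
  proof (cases "k \<ge> 1")
    case True
    hence "k * 2 \<le> k * (k + 1)" by (intro mult_left_mono) auto
    thus ?thesis using two_tri[of k] by simp
  qed auto
  from this[of n] this[of "- 1 - n"] show ?thesis using assms by (simp add: tri_reflect)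
qed

text \<open>The count uses x (x - 1) / 2, which is \<open>tri (x - 1)\<close>; a shift of all
  coordinates by one matches it. As \<open>psi2\<close> sums over all integers, no factor 16
  occurs.\<close>

lemma num_tri_reps_sums:
  assumes "norm q < 1"
  shows "(\<lambda>n. of_nat (num_tri_reps 1 3 4 12 n) * q ^ n) sums
           (psi2 q * psi2 (q ^ 3) * psi2 (q ^ 4) * psi2 (q ^ 12))"
proof -
  have n: "norm (q ^ k) < 1" if "k > 0" for k using that assms by (intro norm_power_less_one)
  let ?e = "\<lambda>(x, y, z, w). tri x + 3 * tri y + 4 * tri z + 12 * tri w"
  have "((\<lambda>(x, y, z, w). q ^ tri x * ((q ^ 3) ^ tri y * ((q ^ 4) ^ tri z * (q ^ 12) ^ tri w)))
     has_sum (psi2 q * (psi2 (q ^ 3) * (psi2 (q ^ 4) * psi2 (q ^ 12))))) (UNIV \<times> UNIV \<times> UNIV \<times> UNIV)"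
  proof -
    note S1 = summable_psi2[OF assms] and S3 = summable_psi2[OF n[of 3]]
      and S4 = summable_psi2[OF n[of 4]] and S12 = summable_psi2[OF n[of 12]]
    note T34 = abs_summable_times[OF S4 S12]
    have "(\<lambda>p. norm (case p of (z, w) \<Rightarrow> (q ^ 4) ^ tri z * (q ^ 12) ^ tri w)) summable_on UNIV \<times> UNIV"
      using T34(1) by (simp add: case_prod_unfold)
    note T234 = abs_summable_times[OF S3 this]
    have "(\<lambda>p. norm (case p of (y, p) \<Rightarrow> (q ^ 3) ^ tri y *
        (case p of (z, w) \<Rightarrow> (q ^ 4) ^ tri z * (q ^ 12) ^ tri w))) summable_on UNIV \<times> UNIV \<times> UNIV"
      using T234(1) by (simp add: case_prod_unfold)
    note T = abs_summable_times(2)[OF S1 this]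
    show ?thesis using T T234(2) T34(2) by (simp add: psi2_def case_prod_unfold infsumI)
  qed
  hence "((\<lambda>t. 1 * q ^ ?e t) has_sum (psi2 q * psi2 (q ^ 3) * psi2 (q ^ 4) * psi2 (q ^ 12))) UNIV"
    by (simp add: case_prod_unfold power_add power_mult mult.assoc)
  moreover have fin: "finite {t \<in> UNIV. ?e t = n}" for n
  proof (rule finite_subset)
    let ?I = "{- 1 - int n..int n}"
    show "{t \<in> UNIV. ?e t = n} \<subseteq> ?I \<times> ?I \<times> ?I \<times> ?I"
    proof
      fix t assume t: "t \<in> {t \<in> UNIV. ?e t = n}"
      obtain x y z w where xyzw: "t = (x, y, z, w)" by (cases t)
      have "tri x \<le> n" "tri y \<le> n" "tri z \<le> n" "tri w \<le> n" using t by (auto simp: xyzw)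
      thus "t \<in> ?I \<times> ?I \<times> ?I \<times> ?I" unfolding xyzw mem_Sigma_iff by (blast intro: tri_le_bounds)
    qed
  qed auto
  ultimately have "((\<lambda>n. (\<Sum>t | t \<in> UNIV \<and> ?e t = n. 1) * q ^ n)
      has_sum (psi2 q * psi2 (q ^ 3) * psi2 (q ^ 4) * psi2 (q ^ 12))) UNIV"
    by (rule has_sum_group_powers)
  moreover have "num_tri_reps 1 3 4 12 n = card {t. ?e t = n}" for n
  proof -
    have tri: "x * (x - 1) div 2 = int (tri (x - 1))" for x
      using two_tri[of "x - 1"] by (simp add: mult.commute)
    have "bij_betw (\<lambda>(x, y, z, w). (x - 1, y - 1, z - 1, w - 1)) {(x, y, z, w). int n
        = int 1 * (x * (x - 1) div 2) + int 3 * (y * (y - 1) div 2)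
          + int 4 * (z * (z - 1) div 2) + int 12 * (w * (w - 1) div 2)} {t. ?e t = n}"
      by (rule bij_betwI[where g = "\<lambda>(x, y, z, w). (x + 1, y + 1, z + 1, w + 1)"])
         (auto simp: tri)
    thus ?thesis unfolding num_tri_reps_def by (rule bij_betw_same_card)
  qed
  ultimately show ?thesis using has_sum_imp_sums by simp
qed

section \<open>Comparison of coefficients\<close>

lemma odd_lambert_square:
  assumes "norm q < 1" "q \<noteq> 0"
  shows "4 * odd_lambert q ^ 2 = q ^ 2 * phi (q ^ 2) * phi (q ^ 6) * psi2 (q ^ 4) * psi2 (q ^ 12)"
proof -
  have n: "norm (q ^ k) < 1" "q ^ k \<noteq> 0" if "k > 0" for k
    using that assms by (auto intro: norm_power_less_one)
  have "16 * odd_lambert q ^ 2 = (4 * odd_lambert q) ^ 2" by (simp add: power_mult_distrib)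
  also have "\<dots> = q ^ 2 * psi2 (q ^ 2) ^ 2 * psi2 (q ^ 6) ^ 2"
    unfolding odd_lambert_eq_psi[OF assms] by (simp add: power_mult_distrib)
  also have "\<dots> = 4 * (q ^ 2 * phi (q ^ 2) * phi (q ^ 6) * psi2 (q ^ 4) * psi2 (q ^ 12))"
    using psi2_square[OF n, of 2] psi2_square[OF n, of 6] by (simp flip: power_mult)
  finally show ?thesis by simp
qed

text \<open>In \<open>odd_lambert q ^ 2\<close> only even exponents occur, and the difference keeps,
  doubled, those congruent to 2 modulo 4. Since q^2 changes sign under q to i q, the two
  \<open>phi\<close> products are added; their dissection leaves
  \<open>phi (q ^ 8) * phi (q ^ 24)\<close>, which \<open>phi_odd_part\<close> converts so that the
  eta product appears.\<close>

lemma theta_main_identity: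
  fixes q :: complex
  assumes q: "norm q < 1" "q \<noteq> 0"
  shows "odd_lambert q ^ 2 - odd_lambert (\<i> * q) ^ 2
       = 2 * q ^ 2 * (\<Prod>k. eta_factor (Suc k) (\<i> * q ^ 2))
         + q ^ 10 * (psi2 (q ^ 4) * psi2 (q ^ 12) * psi2 (q ^ 16) * psi2 (q ^ 48))"
proof -
  have n: "norm (q ^ k) < 1" "q ^ k \<noteq> 0" if "k > 0" for k
    using that q by (auto intro: norm_power_less_one)
  have n': "norm (- (q ^ k)) < 1" "- (q ^ k) \<noteq> 0" if "k > 0" for k
    using n[OF that] by auto
  have i: "(\<i> * q) ^ 2 = - (q ^ 2)" "(\<i> * q) ^ 4 = q ^ 4" "(\<i> * q) ^ 6 = - (q ^ 6)" "(\<i> * q) ^ 12 = q ^ 12"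
    using power_mult[of \<i> 2 3] power_mult[of \<i> 4 3] by (simp_all add: power_mult_distrib)
  have P1: "phi (q ^ 2) = phi (q ^ 8) + q ^ 2 * psi2 (q ^ 16)"
    using phi_parity[OF n, of 2] by (simp flip: power_mult)
  have P2: "phi (q ^ 6) = phi (q ^ 24) + q ^ 6 * psi2 (q ^ 48)"
    using phi_parity[OF n, of 6] by (simp flip: power_mult)
  have P3: "phi (- (q ^ 2)) = phi (q ^ 8) - q ^ 2 * psi2 (q ^ 16)"
    using phi_parity[OF n', of 2] by (simp flip: power_mult)
  have P4: "phi (- (q ^ 6)) = phi (q ^ 24) - q ^ 6 * psi2 (q ^ 48)"
    using phi_parity[OF n', of 6] by (simp flip: power_mult)
  have P5: "phi (q ^ 8) * phi (q ^ 24) = phi (- (q ^ 8)) * phi (- (q ^ 24)) + q ^ 8 * psi2 (q ^ 16) * psi2 (q ^ 48)"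
    using phi_odd_part[OF n, of 8] by (simp add: diff_eq_eq flip: power_mult)
  have eta: "4 * (\<Prod>k. eta_factor (Suc k) (\<i> * q ^ 2))
      = psi2 (q ^ 4) * phi (- (q ^ 8)) * (psi2 (q ^ 12) * phi (- (q ^ 24)))"
  proof -
    have j: "(\<i> * q ^ 2) ^ 2 = - (q ^ 4)" "(\<i> * q ^ 2) ^ 4 = q ^ 8" "(\<i> * q ^ 2) ^ 6 = - (q ^ 12)"
      "(\<i> * q ^ 2) ^ 12 = q ^ 24"
      using power_mult[of \<i> 2 3] power_mult[of \<i> 4 3] by (simp_all add: power_mult_distrib flip: power_mult)
    have "norm (\<i> * q ^ 2) < 1" using n[of 2] by (simp add: norm_mult)
    from eta_product[OF this]
    have "4 * (\<Prod>k. eta_factor (Suc k) (\<i> * q ^ 2))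
        = (2 * euler_prod (- (q ^ 4)) * euler_prod (q ^ 8)) * (2 * euler_prod (- (q ^ 12)) * euler_prod (q ^ 24))"
      unfolding j by simp
    moreover have "2 * euler_prod (- (q ^ 4)) * euler_prod (q ^ 8) = psi2 (q ^ 4) * phi (- (q ^ 8))"
      "2 * euler_prod (- (q ^ 12)) * euler_prod (q ^ 24) = psi2 (q ^ 12) * phi (- (q ^ 24))"
      using euler_pair_psi_phi[OF n, of 4] euler_pair_psi_phi[OF n, of 12]
      by (simp_all flip: power_mult)
    ultimately show ?thesis by (simp only:)
  qed
  have iq: "norm (\<i> * q) < 1" "\<i> * q \<noteq> 0" using q by (auto simp: norm_mult)
  let ?A = "phi (q ^ 8)" and ?B = "phi (q ^ 24)" and ?C = "psi2 (q ^ 16)" and ?D = "psi2 (q ^ 48)"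
    and ?P = "psi2 (q ^ 4) * psi2 (q ^ 12)"
  have "4 * (odd_lambert q ^ 2 - odd_lambert (\<i> * q) ^ 2)
      = q ^ 2 * ?P * (phi (q ^ 2) * phi (q ^ 6) + phi (- (q ^ 2)) * phi (- (q ^ 6)))"
    using odd_lambert_square[OF q] odd_lambert_square[OF iq] unfolding i by (simp add: algebra_simps)
  also have "phi (q ^ 2) * phi (q ^ 6) + phi (- (q ^ 2)) * phi (- (q ^ 6)) = 2 * (?A * ?B) + 2 * (q ^ 8 * ?C * ?D)"
    unfolding P1 P2 P3 P4 by (simp add: algebra_simps flip: power_add)
  also have "\<dots> = 2 * (phi (- (q ^ 8)) * phi (- (q ^ 24))) + 4 * (q ^ 8 * ?C * ?D)"
    unfolding P5 by simp
  also have "q ^ 2 * ?P * \<dots> = 2 * q ^ 2 * (psi2 (q ^ 4) * phi (- (q ^ 8)) * (psi2 (q ^ 12) * phi (- (q ^ 24))))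
      + 4 * (q ^ 10 * (psi2 (q ^ 4) * psi2 (q ^ 12) * ?C * ?D))"
    by (simp add: algebra_simps flip: power_add)
  also have "\<dots> = 4 * (2 * q ^ 2 * (\<Prod>k. eta_factor (Suc k) (\<i> * q ^ 2))
      + q ^ 10 * (psi2 (q ^ 4) * psi2 (q ^ 12) * ?C * ?D))"
    unfolding eta[symmetric] by (simp add: algebra_simps)
  finally show ?thesis by (simp only: mult_left_cancel[OF numeral_neq_zero])
qed

text \<open>Uniqueness of power series coefficients, with the point 0 handled by
  \<open>c 0 = 0\<close>, since the identities above hold for \<open>q \<noteq> 0\<close>. A nonzero
  coefficient would make the zero function nonzero on a punctured disc.\<close>

lemma powser_unique_punctured:
  fixes c :: "nat \<Rightarrow> complex"
  assumes "\<And>q. norm q < 1 \<Longrightarrow> q \<noteq> 0 \<Longrightarrow> (\<lambda>m. c m * q ^ m) sums 0" "c 0 = 0"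
  shows "c m = 0"
proof (rule ccontr)
  assume m: "c m \<noteq> 0"
  have "(\<lambda>m. c m * (q - 0) ^ m) sums 0" if "norm (q - 0) < 1" for q
    using assms that by (cases "q = 0") (auto simp: powser_sums_zero_iff)
  then obtain s where s: "s > 0" "\<And>z :: complex. z \<in> cball 0 s - {0} \<Longrightarrow> (0 :: complex) \<noteq> 0"
    using powser_0_nonzero[where r = 1 and a = c and \<xi> = 0 and f = "\<lambda>_. 0" and m = m] m assms(2) by (metis gr0I zero_less_one)
  thus False using s(2)[of "of_real s"] by auto
qed

theorem theorem3p4:
  fixes n \<beta> n1 :: nat
  assumes "n > 0"
    and "n1 > 0"
    and "2 * n + 5 = 3 ^ \<beta> * n1"
    and "\<not> 3 dvd n1"
  shows "int (num_tri_reps 1 3 4 12 n)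
           = 2 * (int (divisor_sigma n1) - (-1) ^ n * eta_coeff (2 * n + 5))"
proof -
  \<comment> \<open>\<open>C\<close>, \<open>A\<close> and \<open>T\<close> are the coefficients of
    the series in \<open>theta_main_identity\<close>. The series of \<open>A\<close> is the
    q-expansion at i q^2 and thus has a factor i q^2, which \<open>- 2 * \<i>\<close> turns into 2
    q^2.\<close>
  define C :: "nat \<Rightarrow> complex" where
    "C m = of_int (\<Sum>(d, x, e, y)\<in>odd_quads m. chi3 d * chi3 e)" for m
  define A :: "nat \<Rightarrow> complex" where
    "A m = (if even m then of_int (eta_coeff (m div 2)) * \<i> ^ (m div 2) else 0)" for m
  define T :: "nat \<Rightarrow> complex" where
    "T m = (if m \<in> range (\<lambda>k. 4 * k + 10) then of_nat (num_tri_reps 1 3 4 12 ((m - 10) div 4)) else 0)" for m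
  define c where "c m = C m * (1 - \<i> ^ m) - (- 2 * \<i> * A m + T m)" for m
  \<comment> \<open>At this exponent 1 - i^m = 2, and 2 (2 n + 5) = 4 n + 10 is the place of the
    n-th coefficient in the series multiplied by q^10.\<close>
  have "c (2 * (2 * n + 5)) = 0"
  proof (rule powser_unique_punctured)
    have "odd_quads 0 = {}" by (auto simp: odd_quads_def odd_pos)
    thus "c 0 = 0" by (auto simp: c_def C_def A_def T_def eta_coeff_0)
    fix q :: complex assume q: "norm q < 1" "q \<noteq> 0"
    have sC: "(\<lambda>m. C m * q ^ m - C m * (\<i> * q) ^ m) sums (odd_lambert q ^ 2 - odd_lambert (\<i> * q) ^ 2)"
      unfolding C_def using q by (intro sums_diff odd_lambert_square_sums) (auto simp: norm_mult)
    have sA: "(\<lambda>m. A m * q ^ m) sums (\<i> * q ^ 2 * (\<Prod>k. eta_factor (Suc k) (\<i> * q ^ 2)))"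
    proof -
      have "norm (\<i> * q ^ 2) < 1" using norm_power_less_one[OF q(1), of 2] by (simp add: norm_mult)
      moreover have "of_int (eta_coeff k) * (\<i> * q ^ 2) ^ k = A (2 * k) * q ^ (2 * k)" for k
        by (simp add: A_def power_mult_distrib power_mult)
      ultimately have "(\<lambda>k. A (2 * k) * q ^ (2 * k)) sums (\<i> * q ^ 2 * (\<Prod>k. eta_factor (Suc k) (\<i> * q ^ 2)))"
        using eta_coeff_sums[of "\<i> * q ^ 2"] by simp
      thus ?thesis
        by (subst (asm) sums_mono_reindex[of "\<lambda>k. 2 * k" "\<lambda>m. A m * q ^ m"])
           (auto simp: strict_mono_def A_def elim!: evenE)
    qed
    have sT: "(\<lambda>m. T m * q ^ m) sums
        (q ^ 10 * (psi2 (q ^ 4) * psi2 (q ^ 12) * psi2 (q ^ 16) * psi2 (q ^ 48)))"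
    proof -
      have q4: "norm (q ^ 4) < 1" by (intro norm_power_less_one q) auto
      have "q ^ 10 * (of_nat (num_tri_reps 1 3 4 12 k) * (q ^ 4) ^ k) = T (4 * k + 10) * q ^ (4 * k + 10)" for k
        by (simp add: T_def power_add power_mult)
      hence "(\<lambda>k. T (4 * k + 10) * q ^ (4 * k + 10)) sums
          (q ^ 10 * (psi2 (q ^ 4) * psi2 (q ^ 12) * psi2 (q ^ 16) * psi2 (q ^ 48)))"
        using sums_mult[OF num_tri_reps_sums[OF q4], of "q ^ 10"] by (simp flip: power_mult[of q 4])
      thus ?thesis
        by (subst (asm) sums_mono_reindex[of "\<lambda>k. 4 * k + 10" "\<lambda>m. T m * q ^ m"])
           (auto simp: strict_mono_def T_def)
    qed
    from sums_diff[OF sC sums_add[OF sums_mult[OF sA, of "- 2 * \<i>"] sT]]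
    show "(\<lambda>m. c m * q ^ m) sums 0"
      unfolding theta_main_identity[OF q] by (simp add: c_def power_mult_distrib algebra_simps)
  qed
  moreover have "C (2 * (2 * n + 5)) = of_nat (divisor_sigma n1)"
    using sum_chi3_odd_quads[OF _ assms(3,4)] by (simp add: C_def)
  moreover have "A (2 * (2 * n + 5)) = \<i> * (- 1) ^ n * of_int (eta_coeff (2 * n + 5))"
  proof -
    have "\<i> ^ 5 = \<i>" by (simp add: eval_nat_numeral)
    hence "\<i> ^ (2 * n + 5) = \<i> * (- 1) ^ n" by (simp add: power_add power_mult)
    moreover have "A (2 * k) = of_int (eta_coeff k) * \<i> ^ k" for k by (simp add: A_def)
    ultimately show ?thesis by (metis mult.commute)
  qed
  moreover have "T (2 * (2 * n + 5)) = of_nat (num_tri_reps 1 3 4 12 n)"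
  proof -
    have "2 * (2 * n + 5) = 4 * n + 10" by simp
    thus ?thesis by (simp only: T_def) simp
  qed
  moreover have "\<i> ^ (2 * (2 * n + 5)) = - 1"
    unfolding power_mult[of \<i> 2] by simp
  ultimately have "of_int (int (num_tri_reps 1 3 4 12 n))
      = (of_int (2 * (int (divisor_sigma n1) - (-1) ^ n * eta_coeff (2 * n + 5))) :: complex)"
    by (simp add: c_def algebra_simps)
  thus ?thesis by (simp only: of_int_eq_iff)
qed

end
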